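(* In the cost setting described in the context, the (expected pseudo-)regret incurred by the subroutine CSE run with elimination threshold $B>0$ (i.e. $\mathbb{E}[\sum_t\Delta_{i_t}]$ summed over the steps played by CSE until it returns) is at most $$\sum_{i:\Delta_i>0}\frac{129\log T}{\Delta_i}+8D\min\{B,\;D\Delta_{\max}\}\log K .$$
   Context: Delay-as-payoff bandit: there are $K$ arms, a horizon $T$ and a maximum delay $D\in\mathbb{N}$. Each arm $i\in[K]$ has an unknown distribution $\mathcal{D}_i$ supported on $\{0,1,\dots,D\}$. At each step $t$ the agent chooses an arm $i_t$ based on the feedback observed so far, and a delay $d_t\sim\mathcal{D}_{i_t}$ is drawn independently; $d_t$ is revealed only at time $t+d_t$. The payoff of step $t$ is the cost $c_t=d_t/D$, to be minimized. Let $\mu(i)=\mathbb{E}_{X\sim\mathcal{D}_i}[X/D]$, $\mu^*=\min_i\mu(i)$ attained at a unique arm $i^*$, $\Delta_i=\mu(i)-\mu^*$, $\Delta_{\max}=\max_i\Delta_i$. Notation at time $t$: $n_t(i)$ is the number of steps $s\le t$ with $i_s=i$; $M_t(i)=\{s\le t: i_s=i,\ s+d_s\ge t\}$, $m_t(i)=|M_t(i)|$; $\mathcal{O}_t(i)=\{s\le t: i_s=i,\ s+d_s<t\}$; $F_t(i)=\{s\le t-D: i_s=i\}$; $a\vee b=\max\{a,b\}$. CSE (Cost Successive Elimination) with inputs $T$, $K$, $D$, threshold $B$: start with $t=1$ and active set $S=[K]$. While $t<T$: play each arm of $S$ once (round robin), observe arriving feedback, set $t\leftarrow t+|S|$; for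 each $i\in S$ compute $\hat\mu^-_t(i)=\frac{1}{n_t(i)}\big(\sum_{s\in M_t(i)}\frac{t-s}{D}+\sum_{s\in\mathcal{O}_t(i)}c_s\big)$, $L^1_t(i)=\hat\mu^-_t(i)-\sqrt{2\log T/n_t(i)}$; $\hat\mu^F_t(i)=\frac{1}{|F_t(i)|\vee1}\sum_{s\in F_t(i)}c_s$, $L^2_t(i)=\hat\mu^F_t(i)-\sqrt{2\log T/(|F_t(i)|\vee1)}$; $L^3_t(i)=\frac{|S|}{D}\big(\frac{m_t(i)}{2}-8\log T-1\big)$; $LCB_t(i)=\max\{L^1_t(i),L^2_t(i),L^3_t(i)\}$, $UCB_t(i)=\hat\mu^F_t(i)+\sqrt{2\log T/(|F_t(i)|\vee1)}$. Then remove from $S$ every arm $i$ for which some $j\in S$ has $\min\{UCB_t(j),B\}<LCB_t(i)$; if $S=\emptyset$ return (Fail, $t$). If the loop ends return (Success, $t$). *)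

theory Defs
  imports "HOL-Probability.Probability"
begin

text \<open>Delay-as-payoff bandit and the subroutine CSE.
  Arms are 0..K-1. A delay table X maps (step s, arm i) to the delay that
  would be drawn if arm i were played at step s; entries are independent,
  X(s,i) ~ Dist i. The delay of step s is X(s, a s), where a s is the arm
  played at step s. Steps played so far are 1..t-1.\<close>

definition delay :: "(nat \<times> nat \<Rightarrow> nat) \<Rightarrow> (nat \<Rightarrow> nat) \<Rightarrow> nat \<Rightarrow> nat" where
  "delay X a s = X (s, a s)"

definition cost :: "nat \<Rightarrow> (nat \<times> nat \<Rightarrow> nat) \<Rightarrow> (nat \<Rightarrow> nat) \<Rightarrow> nat \<Rightarrow> real" where
  "cost D X a s = real (delay X a s) / real D"

definition n_cnt :: "(nat \<Rightarrow> nat) \<Rightarrow> nat \<Rightarrow> nat \<Rightarrow> nat" where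
  "n_cnt a t i = card {s \<in> {1..<t}. a s = i}"

definition M_set :: "(nat \<times> nat \<Rightarrow> nat) \<Rightarrow> (nat \<Rightarrow> nat) \<Rightarrow> nat \<Rightarrow> nat \<Rightarrow> nat set" where
  "M_set X a t i = {s \<in> {1..<t}. a s = i \<and> s + delay X a s \<ge> t}"

definition O_set :: "(nat \<times> nat \<Rightarrow> nat) \<Rightarrow> (nat \<Rightarrow> nat) \<Rightarrow> nat \<Rightarrow> nat \<Rightarrow> nat set" where
  "O_set X a t i = {s \<in> {1..<t}. a s = i \<and> s + delay X a s < t}"

definition F_set :: "nat \<Rightarrow> (nat \<Rightarrow> nat) \<Rightarrow> nat \<Rightarrow> nat \<Rightarrow> nat set" where
  "F_set D a t i = {s \<in> {1..<t}. a s = i \<and> s + D \<le> t}"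

definition mu_minus_hat :: "nat \<Rightarrow> (nat \<times> nat \<Rightarrow> nat) \<Rightarrow> (nat \<Rightarrow> nat) \<Rightarrow> nat \<Rightarrow> nat \<Rightarrow> real" where
  "mu_minus_hat D X a t i =
     (1 / real (n_cnt a t i)) *
     ((\<Sum>s\<in>M_set X a t i. (real t - real s) / real D) + (\<Sum>s\<in>O_set X a t i. cost D X a s))"

definition mu_F_hat :: "nat \<Rightarrow> (nat \<times> nat \<Rightarrow> nat) \<Rightarrow> (nat \<Rightarrow> nat) \<Rightarrow> nat \<Rightarrow> nat \<Rightarrow> real" where
  "mu_F_hat D X a t i =
     (1 / real (max (card (F_set D a t i)) 1)) * (\<Sum>s\<in>F_set D a t i. cost D X a s)"

definition LCB :: "nat \<Rightarrow> nat \<Rightarrow> (nat \<times> nat \<Rightarrow> nat) \<Rightarrow> (nat \<Rightarrow> nat) \<Rightarrow> nat set \<Rightarrow> nat \<Rightarrow> nat \<Rightarrow> real" where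
  "LCB T D X a S t i =
     (let L1 = mu_minus_hat D X a t i - sqrt (2 * ln (real T) / real (n_cnt a t i));
          L2 = mu_F_hat D X a t i - sqrt (2 * ln (real T) / real (max (card (F_set D a t i)) 1));
          L3 = real (card S) / real D * (real (card (M_set X a t i)) / 2 - 8 * ln (real T) - 1)
      in max L1 (max L2 L3))"

definition UCB :: "nat \<Rightarrow> nat \<Rightarrow> (nat \<times> nat \<Rightarrow> nat) \<Rightarrow> (nat \<Rightarrow> nat) \<Rightarrow> nat \<Rightarrow> nat \<Rightarrow> real" where
  "UCB T D X a t i =
     mu_F_hat D X a t i + sqrt (2 * ln (real T) / real (max (card (F_set D a t i)) 1))"

definition cse_round :: "nat \<Rightarrow> nat \<Rightarrow> real \<Rightarrow> (nat \<times> nat \<Rightarrow> nat) \<Rightarrow>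
     nat \<times> nat set \<times> (nat \<Rightarrow> nat) \<Rightarrow> nat \<times> nat set \<times> (nat \<Rightarrow> nat)" where
  "cse_round T D B X st =
     (case st of (t, S, a) \<Rightarrow>
       (let a' = (\<lambda>s. if t \<le> s \<and> s < t + card S then sorted_list_of_set S ! (s - t) else a s);
            t' = t + card S;
            S' = {i \<in> S. \<not> (\<exists>j\<in>S. min (UCB T D X a' t' j) B < LCB T D X a' S t' i)}
        in (t', S', a')))"

datatype cse_outcome = Success | Fail

text \<open>The main loop, with a fuel argument (T rounds always suffice, since t starts at 1
  and increases by |S| \<ge> 1 per round). Returns outcome, final time t, arm assignment.\<close>

fun cse_loop :: "nat \<Rightarrow> nat \<Rightarrow> nat \<Rightarrow> real \<Rightarrow> (nat \<times> nat \<Rightarrow> nat) \<Rightarrow>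
     nat \<times> nat set \<times> (nat \<Rightarrow> nat) \<Rightarrow> cse_outcome \<times> nat \<times> (nat \<Rightarrow> nat)" where
  "cse_loop 0 T D B X (t, S, a) = (Success, t, a)"
| "cse_loop (Suc f) T D B X (t, S, a) =
     (if t < T then
        (case cse_round T D B X (t, S, a) of (t', S', a') \<Rightarrow>
           (if S' = {} then (Fail, t', a') else cse_loop f T D B X (t', S', a')))
      else (Success, t, a))"

definition cse_run :: "nat \<Rightarrow> nat \<Rightarrow> nat \<Rightarrow> real \<Rightarrow> (nat \<times> nat \<Rightarrow> nat) \<Rightarrow>
     cse_outcome \<times> nat \<times> (nat \<Rightarrow> nat)" where
  "cse_run K T D B X = cse_loop T T D B X (1, {..<K}, (\<lambda>_. 0))"

definition mean_cost :: "nat \<Rightarrow> (nat \<Rightarrow> nat pmf) \<Rightarrow> nat \<Rightarrow> real" where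
  "mean_cost D Dist i = measure_pmf.expectation (Dist i) (\<lambda>x. real x / real D)"

definition gap :: "nat \<Rightarrow> nat \<Rightarrow> (nat \<Rightarrow> nat pmf) \<Rightarrow> nat \<Rightarrow> real" where
  "gap K D Dist i = mean_cost D Dist i - Min (mean_cost D Dist ` {..<K})"

definition gap_max :: "nat \<Rightarrow> nat \<Rightarrow> (nat \<Rightarrow> nat pmf) \<Rightarrow> real" where
  "gap_max K D Dist = Max (gap K D Dist ` {..<K})"

definition cse_regret :: "nat \<Rightarrow> nat \<Rightarrow> nat \<Rightarrow> real \<Rightarrow> (nat \<Rightarrow> nat pmf) \<Rightarrow> (nat \<times> nat \<Rightarrow> nat) \<Rightarrow> real" where
  "cse_regret K T D B Dist X =
     (case cse_run K T D B X of (_, tf, a) \<Rightarrow> \<Sum>s\<in>{1..<tf}. gap K D Dist (a s))"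

text \<open>Distribution of the delay table: independent entries X(s,i) ~ Dist i for every
  step s < T + K that could possibly be played and every arm i.\<close>

definition delay_table :: "nat \<Rightarrow> nat \<Rightarrow> (nat \<Rightarrow> nat pmf) \<Rightarrow> (nat \<times> nat \<Rightarrow> nat) pmf" where
  "delay_table K T Dist = Pi_pmf ({1..<T + K} \<times> {..<K}) 0 (\<lambda>(s, i). Dist i)"

end

theory Submission
  imports Defs
begin

text \<open>
  Write \<open>L = ln T\<close>. Whether arm \<open>i\<close> is played at step \<open>s\<close> depends only on delays drawn before \<open>s\<close>,
  so exponential supermartingales show that for \<open>K < T\<close> (otherwise there is at most one round) and
  outside an event of probability at most \<open>2 / T\<close>, all confidence bounds are valid: a Hoeffding bound for the first \<open>n\<close> plays of each arm gives \<open>L1\<close>, \<open>L2\<close>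
  and the upper bound, and a Chernoff bound for the number \<open>m\<close> of outstanding plays gives \<open>L3\<close>. For the
  latter, consecutive plays of an active arm are at least \<open>k = |S|\<close> steps apart, hence the expected
  number of outstanding plays is at most \<open>D \<mu>\<^sub>i / k + 1\<close>.

  Suppose arm \<open>i\<close> is still active after \<open>n\<close> rounds. By \<open>L2\<close>, at most \<open>32 L / \<Delta>\<^sub>i\<^sup>2 + O(1)\<close> of its plays are
  older than \<open>D\<close>, and at most \<open>D / k + 1\<close> are younger, so its regret is at most
  \<open>32 L / \<Delta>\<^sub>i + 3 \<Delta>\<^sub>i + D \<Delta>\<^sub>i / k\<close>; this suffices if \<open>B\<close> is at least \<open>\<mu>\<^sub>i / 3\<close> or the maximal gap.
  If \<open>B < \<mu>\<^sub>i / 3\<close>, then \<open>L3 \<le> B\<close> gives \<open>m \<le> 2 (B D / k + 8 L + 1)\<close>, while \<open>L1 \<le> B\<close> gives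
  \<open>(2 / 3) n \<mu>\<^sub>i \<le> 2 sqrt (2 L n) + m\<close>, and the arithmetic-geometric mean inequality bounds \<open>n \<mu>\<^sub>i\<close>.
  Finally \<open>k\<close> is at least the number of suboptimal arms played at least as often as \<open>i\<close>, so the sum of
  \<open>1 / k\<close> over all suboptimal arms is at most a harmonic number.
\<close>

section \<open>Harmonic sums and an auxiliary root\<close>

text \<open>Induction that removes an element with minimal \<open>N\<close>: its denominator is the
  full \<open>card A\<close>, which gives the new harmonic term, and its removal only shrinks the
  other denominators. With \<open>N\<close> the number of plays, these denominators later bound the
  number of active arms from below.\<close>

lemma sum_inverse_rank_le_harm:
  fixes N :: "'a \<Rightarrow> nat"
  assumes "finite A"
  shows "(\<Sum>i\<in>A. 1 / real (card {j \<in> A. N j \<ge> N i})) \<le> harm (card A)"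
  using assms
proof (induction "card A" arbitrary: A)
  case 0
  then show ?case by (simp add: harm_def)
next
  case (Suc n)
  then have ne: "A \<noteq> {}" by auto
  define m where "m = Min (N ` A)"
  have "m \<in> N ` A" unfolding m_def using Suc ne by (intro Min_in) auto
  then obtain i0 where i0: "i0 \<in> A" "N i0 = m" by auto
  have le: "N i0 \<le> N j" if "j \<in> A" for j
    using that Suc i0 unfolding m_def by auto
  let ?A = "A - {i0}"
  have "1 / real (card {j \<in> A. N j \<ge> N i}) \<le> 1 / real (card {j \<in> ?A. N j \<ge> N i})" if "i \<in> ?A" for i
    using that Suc(3) by (intro divide_left_mono of_nat_mono card_mono mult_pos_pos) (auto simp: card_gt_0_iff)
  then have "(\<Sum>i\<in>?A. 1 / real (card {j \<in> A. N j \<ge> N i})) \<le> (\<Sum>i\<in>?A. 1 / real (card {j \<in> ?A. N j \<ge> N i}))"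
    by (rule sum_mono)
  also have "\<dots> \<le> harm n"
  proof -
    have "n = card ?A" using Suc(2)[symmetric] i0(1) by simp
    then show ?thesis using Suc(1)[of ?A] Suc(3) by simp
  qed
  finally have "(\<Sum>i\<in>?A. 1 / real (card {j \<in> A. N j \<ge> N i})) \<le> harm n" .
  moreover have "{j \<in> A. N j \<ge> N i0} = A" using le by auto
  ultimately show ?case
    unfolding Suc(2)[symmetric] harm_Suc sum.remove[OF Suc(3) i0(1)]
    using Suc(2)[symmetric] by (simp add: inverse_eq_divide)
qed

lemma harm_le_1_plus_ln:
  assumes "n \<ge> 1"
  shows "harm n \<le> 1 + ln (real n)"
  using assms
proof (induction n rule: nat_induct_at_least)
  case (Suc n)
  have "ln (real n / real (Suc n)) \<le> real n / real (Suc n) - 1"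
    by (rule ln_le_minus_one) (use Suc in auto)
  then have "inverse (real (Suc n)) \<le> ln (real (Suc n)) - ln (real n)"
    using Suc by (simp add: ln_div field_simps)
  then show ?case using Suc by (simp add: harm_Suc)
qed (simp add: harm_def)

lemma sqrt_mult_divide_self:
  fixes n :: real
  assumes "n > 0"
  shows "sqrt (c * n) / n = sqrt (c / n)"
proof -
  have "sqrt (c * n) / sqrt (n\<^sup>2) = sqrt (c / n)"
    unfolding real_sqrt_divide[symmetric] using assms by (simp add: power2_eq_square)
  then show ?thesis using assms by simp
qed

section \<open>Exponential bounds for predictably selected samples\<close>

text \<open>Fubini for one coordinate. In the outer integral the entry at \<open>x\<close> is the
  default, so anything that ignores this entry may leave the inner integral.\<close>

lemma nn_integral_Pi_pmf_split:
  assumes "finite A" "x \<in> A"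
  shows "(\<integral>\<^sup>+X. h X \<partial>Pi_pmf A d p)
    = (\<integral>\<^sup>+f. (\<integral>\<^sup>+y. h (f(x := y)) \<partial>p x) \<partial>Pi_pmf (A - {x}) d p)"
proof -
  have "Pi_pmf A d p = map_pmf (\<lambda>(y,f). f(x := y)) (pair_pmf (p x) (Pi_pmf (A - {x}) d p))"
    using Pi_pmf_insert[of "A - {x}" x d p] assms by (simp add: insert_absorb)
  then have "(\<integral>\<^sup>+X. h X \<partial>Pi_pmf A d p)
      = (\<integral>\<^sup>+z. h ((snd z)(x := fst z)) \<partial>pair_pmf (p x) (Pi_pmf (A - {x}) d p))"
    by (simp add: case_prod_beta)
  also have "\<dots> = (\<integral>\<^sup>+z. h ((fst z)(x := snd z)) \<partial>pair_pmf (Pi_pmf (A - {x}) d p) (p x))"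
    by (subst pair_commute_pmf) (simp add: case_prod_beta)
  finally show ?thesis by (simp add: nn_integral_pair_pmf')
qed

text \<open>The supermartingale argument: the entry of the last step is integrated first. All
  earlier factors and the selection of the last step ignore this entry, so the inner integral
  contributes a factor of at most 1.\<close>

lemma nn_integral_predictable_prod_le_1:
  fixes p :: "nat \<times> 'b \<Rightarrow> 'c pmf" and g :: "nat \<Rightarrow> 'c \<Rightarrow> ennreal"
  assumes "finite A"
    and A: "\<And>s. s \<in> {1..<N} \<Longrightarrow> (s, i) \<in> A"
    and sel: "\<And>s X Y. (\<And>s' j. s' < s \<Longrightarrow> X (s', j) = Y (s', j)) \<Longrightarrow> sel s X \<longleftrightarrow> sel s Y"
    and g: "\<And>s. s \<in> {1..<N} \<Longrightarrow> (\<integral>\<^sup>+y. g s y \<partial>p (s, i)) \<le> 1"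
  shows "(\<integral>\<^sup>+X. (\<Prod>s\<in>{1..<N}. if sel s X then g s (X (s, i)) else 1) \<partial>Pi_pmf A d p) \<le> 1"
  using A g
proof (induction N)
  case (Suc N)
  let ?W = "\<lambda>N X. \<Prod>s\<in>{1..<N}. if sel s X then g s (X (s, i)) else 1"
  show ?case
  proof (cases "N = 0")
    case False
    then have NA: "(N, i) \<in> A" using Suc.prems by simp
    have sel_upd: "sel s (f((N, i) := y)) \<longleftrightarrow> sel s f" if "s \<le> N" for s f y
      using that by (intro sel) auto
    have W_upd: "?W N (f((N, i) := y)) = ?W N f" for f y
      by (intro prod.cong) (auto simp: sel_upd)
    have W_Suc: "?W (Suc N) X = ?W N X * (if sel N X then g N (X (N, i)) else 1)" for X
      using False by (simp add: atLeastLessThanSuc mult.commute)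
    have "(\<integral>\<^sup>+X. ?W (Suc N) X \<partial>Pi_pmf A d p)
       = (\<integral>\<^sup>+f. (\<integral>\<^sup>+y. ?W N f * (if sel N f then g N y else 1) \<partial>p (N, i)) \<partial>Pi_pmf (A - {(N, i)}) d p)"
      unfolding W_Suc nn_integral_Pi_pmf_split[OF \<open>finite A\<close> NA] W_upd sel_upd[OF order_refl] fun_upd_same ..
    also have "\<dots> \<le> (\<integral>\<^sup>+f. ?W N f \<partial>Pi_pmf (A - {(N, i)}) d p)"
    proof (rule nn_integral_mono)
      fix f
      have "(\<integral>\<^sup>+y. (if sel N f then g N y else 1) \<partial>p (N, i)) \<le> 1"
        using Suc.prems(2)[of N] False by (cases "sel N f") auto
      then show "(\<integral>\<^sup>+y. ?W N f * (if sel N f then g N y else 1) \<partial>p (N, i)) \<le> ?W N f"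
        by (simp add: nn_integral_cmult mult_left_le)
    qed
    also have "\<dots> = (\<integral>\<^sup>+X. ?W N X \<partial>Pi_pmf A d p)"
      unfolding nn_integral_Pi_pmf_split[OF \<open>finite A\<close> NA] W_upd by simp
    also have "\<dots> \<le> 1" using Suc by simp
    finally show ?thesis .
  qed simp
qed simp

lemma measure_pmf_Markov:
  assumes "(\<integral>\<^sup>+X. ennreal (exp (h X)) \<partial>measure_pmf M) \<le> 1"
  shows "measure_pmf.prob M {X. h X \<ge> c} \<le> exp (- c)"
proof -
  have "ennreal (exp c) * emeasure M {X. h X \<ge> c}
      = (\<integral>\<^sup>+X. ennreal (exp c) * indicator {X. h X \<ge> c} X \<partial>M)"
    by (simp add: nn_integral_cmult)
  also have "\<dots> \<le> (\<integral>\<^sup>+X. ennreal (exp (h X)) \<partial>M)"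
    by (intro nn_integral_mono) (auto simp: indicator_def intro!: ennreal_leI)
  finally have "ennreal (exp c * measure_pmf.prob M {X. h X \<ge> c}) \<le> 1"
    using assms by (simp add: measure_pmf.emeasure_eq_measure ennreal_mult)
  then have "exp c * measure_pmf.prob M {X. h X \<ge> c} \<le> 1" by simp
  then show ?thesis by (simp add: exp_minus field_simps)
qed

text \<open>Exponential Markov inequality for the preceding product. Steps that are not selected
  contribute the factor 1, so the number of summands may be random.\<close>

lemma prob_predictable_sum_ge:
  fixes p :: "nat \<times> 'b \<Rightarrow> 'c pmf" and g :: "nat \<Rightarrow> 'c \<Rightarrow> real"
  assumes "finite A"
    and "\<And>s. s \<in> {1..<N} \<Longrightarrow> (s, i) \<in> A"
    and "\<And>s X Y. (\<And>s' j. s' < s \<Longrightarrow> X (s', j) = Y (s', j)) \<Longrightarrow> sel s X \<longleftrightarrow> sel s Y"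
    and "\<And>s. s \<in> {1..<N} \<Longrightarrow> (\<integral>\<^sup>+y. ennreal (exp (g s y)) \<partial>p (s, i)) \<le> 1"
  shows "measure_pmf.prob (Pi_pmf A d p)
    {X. (\<Sum>s\<in>{s\<in>{1..<N}. sel s X}. g s (X (s, i))) \<ge> c} \<le> exp (- c)"
proof (rule measure_pmf_Markov)
  have "ennreal (exp (\<Sum>s\<in>{s\<in>{1..<N}. sel s X}. g s (X (s, i))))
     = (\<Prod>s\<in>{1..<N}. if sel s X then ennreal (exp (g s (X (s, i)))) else 1)" for X
  proof -
    have "exp (\<Sum>s\<in>{s\<in>{1..<N}. sel s X}. g s (X (s, i)))
       = (\<Prod>s\<in>{1..<N}. if sel s X then exp (g s (X (s, i))) else 1)"
      by (subst prod.inter_filter[symmetric]) (simp_all add: exp_sum)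
    also have "ennreal \<dots> = (\<Prod>s\<in>{1..<N}. ennreal (if sel s X then exp (g s (X (s, i))) else 1))"
      by (rule prod_ennreal[symmetric]) simp
    also have "\<dots> = (\<Prod>s\<in>{1..<N}. if sel s X then ennreal (exp (g s (X (s, i)))) else 1)"
      by (intro prod.cong) auto
    finally show ?thesis .
  qed
  then show "(\<integral>\<^sup>+X. ennreal (exp (\<Sum>s\<in>{s\<in>{1..<N}. sel s X}. g s (X (s, i)))) \<partial>Pi_pmf A d p) \<le> 1"
    using nn_integral_predictable_prod_le_1[where g = "\<lambda>s y. ennreal (exp (g s y))", OF assms] by simp
qed

text \<open>Hoeffding's lemma in normalised form, for both signs of \<open>l\<close> because both
  tails are needed. A negative \<open>l\<close> is treated by passing to \<open>- f\<close>, whose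
  values lie in \<open>{- 1..0}\<close>; hence the auxiliary fact for an arbitrary interval of
  length 1.\<close>

lemma nn_integral_exp_Hoeffding_le_1:
  fixes q :: "'a pmf" and f :: "'a \<Rightarrow> real"
  assumes f: "\<And>x. x \<in> set_pmf q \<Longrightarrow> f x \<in> {0..1}"
    and l: "l \<noteq> 0"
  shows "(\<integral>\<^sup>+x. ennreal (exp (l * (f x - measure_pmf.expectation q f) - l\<^sup>2 / 8)) \<partial>q) \<le> 1"
proof -
  have *: "(\<integral>\<^sup>+x. ennreal (exp (l * (f x - measure_pmf.expectation q f) - l\<^sup>2 / 8)) \<partial>q) \<le> 1"
    if l: "l > 0" and f: "\<And>x. x \<in> set_pmf q \<Longrightarrow> f x \<in> {a..a+1}" for l a and f :: "'a \<Rightarrow> real"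
  proof -
    interpret interval_bounded_random_variable "measure_pmf q" f a "a + 1"
      by unfold_locales (use f in \<open>auto simp: AE_measure_pmf_iff\<close>)
    have "(\<integral>\<^sup>+x. ennreal (exp (l * (f x - measure_pmf.expectation q f))) \<partial>q) \<le> ennreal (exp (l\<^sup>2 / 8))"
      using Hoeffdings_lemma_nn_integral[OF l] by simp
    then have "(\<integral>\<^sup>+x. ennreal (exp (- (l\<^sup>2 / 8))) * ennreal (exp (l * (f x - measure_pmf.expectation q f))) \<partial>q)
       \<le> ennreal (exp (- (l\<^sup>2 / 8))) * ennreal (exp (l\<^sup>2 / 8))"
      by (subst nn_integral_cmult) (auto intro: mult_left_mono)
    then show ?thesis
      by (simp add: ennreal_mult[symmetric] exp_add[symmetric] algebra_simps)
  qed
  show ?thesis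
  proof (cases "l > 0")
    case True
    then show ?thesis using *[of l f 0] f by auto
  next
    case False
    have "f x \<in> {0..1} \<Longrightarrow> - f x \<in> {- 1..- 1 + 1}" for x by auto
    then have "(\<integral>\<^sup>+x. ennreal (exp ((- l) * (- f x - measure_pmf.expectation q (\<lambda>x. - f x)) - (- l)\<^sup>2 / 8)) \<partial>q) \<le> 1"
      using False l f by (intro *[of "- l" "\<lambda>x. - f x" "- 1"]) auto
    then show ?thesis by (simp add: algebra_simps)
  qed
qed

text \<open>The factor 2 is an upper bound for \<open>e - 1\<close>.\<close>

lemma nn_integral_exp_indicator_le_1:
  fixes q :: "'a pmf"
  shows "(\<integral>\<^sup>+x. ennreal (exp (of_bool (x \<in> E) - 2 * measure_pmf.prob q E)) \<partial>q) \<le> 1"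
proof -
  let ?p = "measure_pmf.prob q E"
  have "(\<integral>\<^sup>+x. ennreal (exp (of_bool (x \<in> E) - 2 * ?p)) \<partial>q)
     \<le> (\<integral>\<^sup>+x. ennreal (exp (- 2 * ?p)) * (1 + 2 * indicator E x) \<partial>q)"
  proof (rule nn_integral_mono)
    fix x
    have "exp (of_bool (x \<in> E) - 2 * ?p) \<le> exp (- 2 * ?p) * (1 + 2 * indicator E x)"
      using exp_le by (auto simp: exp_diff exp_minus field_simps indicator_def)
    then have "ennreal (exp (of_bool (x \<in> E) - 2 * ?p)) \<le> ennreal (exp (- 2 * ?p) * (1 + 2 * indicator E x))"
      by (rule ennreal_leI)
    also have "\<dots> = ennreal (exp (- 2 * ?p)) * (1 + 2 * indicator E x)"
      by (subst ennreal_mult) (auto simp: indicator_def)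
    finally show "ennreal (exp (of_bool (x \<in> E) - 2 * ?p)) \<le> ennreal (exp (- 2 * ?p)) * (1 + 2 * indicator E x)" .
  qed
  also have "\<dots> = ennreal (exp (- 2 * ?p)) * (1 + 2 * emeasure q E)"
    by (simp add: nn_integral_cmult nn_integral_add)
  also have "\<dots> = ennreal (exp (- 2 * ?p) * (1 + 2 * ?p))"
    by (simp add: measure_pmf.emeasure_eq_measure ennreal_mult)
  also have "\<dots> \<le> ennreal (exp (- 2 * ?p) * exp (2 * ?p))"
    by (intro ennreal_leI mult_left_mono) (use exp_ge_add_one_self[of "2 * ?p"] in auto)
  also have "\<dots> = 1" by (simp add: exp_add[symmetric])
  finally show ?thesis .
qed

lemma prob_Bex_le:
  assumes "finite S" "\<And>x. x \<in> S \<Longrightarrow> measure_pmf.prob M {X. Q x X} \<le> c"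
  shows "measure_pmf.prob M {X. \<exists>x\<in>S. Q x X} \<le> real (card S) * c"
proof -
  have "{X. \<exists>x\<in>S. Q x X} = (\<Union>x\<in>S. {X. Q x X})" by auto
  also have "measure_pmf.prob M \<dots> \<le> (\<Sum>x\<in>S. measure_pmf.prob M {X. Q x X})"
    using assms(1) by (intro measure_pmf.finite_measure_subadditive_finite) auto
  also have "\<dots> \<le> real (card S) * c" using sum_mono[of S _ "\<lambda>_. c"] assms(2) by auto
  finally show ?thesis .
qed

section \<open>The trajectory of CSE\<close>

text \<open>Turns list positions into ranks, so that the step of an arm inside a round gets the
  closed form \<open>pull_time\<close> and can be compared between rounds.\<close>

lemma sorted_list_of_set_nth_rank:
  fixes S :: "nat set"
  assumes "finite S" "i \<in> S"
  shows "sorted_list_of_set S ! card {j \<in> S. j < i} = i"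
proof -
  define l where "l = sorted_list_of_set S"
  have sl: "sorted_wrt (<) l" "set l = S" "length l = card S" "distinct l"
    using assms by (auto simp: l_def strict_sorted_list_of_set)
  obtain p where p: "p < length l" "l ! p = i"
    using sl assms by (metis in_set_conv_nth)
  have "{j \<in> S. j < i} = (!) l ` {..<p}"
  proof (intro equalityI subsetI)
    fix j assume j: "j \<in> {j \<in> S. j < i}"
    then obtain q where q: "q < length l" "l ! q = j"
      using sl by (metis (no_types, lifting) in_set_conv_nth mem_Collect_eq)
    have "q < p"
    proof (rule ccontr)
      assume "\<not> q < p"
      then have "p = q \<or> p < q" by auto
      then have "i \<le> j"
        using sorted_wrt_nth_less[OF sl(1), of p q] p q by auto
      then show False using j by auto
    qed
    then show "j \<in> (!) l ` {..<p}" using q by auto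
  next
    fix j assume "j \<in> (!) l ` {..<p}"
    then obtain q where "q < p" "j = l ! q" by auto
    then show "j \<in> {j \<in> S. j < i}"
      using sorted_wrt_nth_less[OF sl(1), of q p] p sl(2) nth_mem[of q l] by auto
  qed
  then have "card {j \<in> S. j < i} = p"
    using sl(4) p(1) by (auto simp: card_image inj_on_def nth_eq_iff_index_eq)
  then show ?thesis using p by (simp add: l_def)
qed

text \<open>Rounds are iterated without any stopping condition, so that the arm of a step can be
  discussed independently of the horizon; by \<open>cse_loop_state\<close> below the actual run is an initial segment.\<close>

definition cse_state ::
  "nat \<Rightarrow> nat \<Rightarrow> nat \<Rightarrow> real \<Rightarrow> (nat \<times> nat \<Rightarrow> nat) \<Rightarrow> nat \<Rightarrow> nat \<times> nat set \<times> (nat \<Rightarrow> nat)" where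
  "cse_state K T D B X r = (cse_round T D B X ^^ r) (1, {..<K}, \<lambda>_. 0)"

locale cse =
  fixes K T D :: nat and B :: real
begin

definition start :: "(nat \<times> nat \<Rightarrow> nat) \<Rightarrow> nat \<Rightarrow> nat" where
  "start X r = fst (cse_state K T D B X r)"

definition act :: "(nat \<times> nat \<Rightarrow> nat) \<Rightarrow> nat \<Rightarrow> nat set" where
  "act X r = fst (snd (cse_state K T D B X r))"

definition asg :: "(nat \<times> nat \<Rightarrow> nat) \<Rightarrow> nat \<Rightarrow> nat \<Rightarrow> nat" where
  "asg X r = snd (snd (cse_state K T D B X r))"

lemma cse_state_eq: "cse_state K T D B X r = (start X r, act X r, asg X r)"
  by (simp add: start_def act_def asg_def)

lemma cse_round_state:
  "cse_round T D B X (start X r, act X r, asg X r) = (start X (Suc r), act X (Suc r), asg X (Suc r))"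
  unfolding cse_state_eq[symmetric] by (simp add: cse_state_def)

lemma start_0 [simp]: "start X 0 = 1"
  and act_0 [simp]: "act X 0 = {..<K}"
  and asg_0 [simp]: "asg X 0 = (\<lambda>_. 0)"
  by (simp_all add: start_def act_def asg_def cse_state_def)

lemma start_Suc: "start X (Suc r) = start X r + card (act X r)"
  and asg_Suc: "asg X (Suc r) =
    (\<lambda>s. if start X r \<le> s \<and> s < start X (Suc r)
         then sorted_list_of_set (act X r) ! (s - start X r) else asg X r s)"
  and act_Suc: "act X (Suc r) = {i \<in> act X r. \<not> (\<exists>j\<in>act X r.
    min (UCB T D X (asg X (Suc r)) (start X (Suc r)) j) B
      < LCB T D X (asg X (Suc r)) (act X r) (start X (Suc r)) i)}"
proof -
  note round = cse_round_state[of X r, unfolded cse_round_def Let_def prod.case prod.inject]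
  show start: "start X (Suc r) = start X r + card (act X r)"
    using round by (rule conjunct1[THEN sym])
  show asg: "asg X (Suc r) =
    (\<lambda>s. if start X r \<le> s \<and> s < start X (Suc r)
         then sorted_list_of_set (act X r) ! (s - start X r) else asg X r s)"
    unfolding start using round by (rule conjunct2[THEN conjunct2, THEN sym])
  show "act X (Suc r) = {i \<in> act X r. \<not> (\<exists>j\<in>act X r.
    min (UCB T D X (asg X (Suc r)) (start X (Suc r)) j) B
      < LCB T D X (asg X (Suc r)) (act X r) (start X (Suc r)) i)}"
    unfolding asg start using round by (rule conjunct2[THEN conjunct1, THEN sym])
qed

lemma start_mono: "r \<le> r' \<Longrightarrow> start X r \<le> start X r'"
  by (rule lift_Suc_mono_le[of "start X"]) (auto simp: start_Suc)

lemma start_pos: "start X r \<ge> 1"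
  using start_mono[of 0 r X] by simp

lemma act_antimono: "r \<le> r' \<Longrightarrow> act X r' \<subseteq> act X r"
  by (rule lift_Suc_antimono_le[of "act X"]) (auto simp: act_Suc)

lemma act_subset: "act X r \<subseteq> {..<K}"
  using act_antimono[of 0 r X] by simp

lemma finite_act [simp]: "finite (act X r)"
  using act_subset finite_subset by blast

lemma asg_stable: "r \<le> r' \<Longrightarrow> s < start X r \<Longrightarrow> asg X r' s = asg X r s"
proof (induction r' rule: dec_induct)
  case (step n)
  then show ?case using start_mono[of r n X] by (auto simp: asg_Suc)
qed simp

text \<open>A round plays its active arms in increasing order, so this is the step of arm
  \<open>i\<close> in round \<open>r\<close>; it has this meaning only for active
  \<open>i\<close>.\<close>

definition pull_time :: "(nat \<times> nat \<Rightarrow> nat) \<Rightarrow> nat \<Rightarrow> nat \<Rightarrow> nat" where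
  "pull_time X r i = start X r + card {j \<in> act X r. j < i}"

lemma pull_time_bounds:
  assumes "i \<in> act X r"
  shows "start X r \<le> pull_time X r i" "pull_time X r i < start X (Suc r)"
proof -
  have "card {j \<in> act X r. j < i} < card (act X r)"
    using assms by (intro psubset_card_mono) auto
  then show "pull_time X r i < start X (Suc r)" by (simp add: pull_time_def start_Suc)
qed (simp add: pull_time_def)

lemma asg_round:
  assumes "start X r \<le> s" "s < start X (Suc r)"
  shows "asg X (Suc r) s \<in> act X r"
    and "asg X (Suc r) s = i \<longleftrightarrow> i \<in> act X r \<and> s = pull_time X r i"
proof -
  define l where "l = sorted_list_of_set (act X r)"
  have sl: "set l = act X r" "length l = card (act X r)" "distinct l"
    by (auto simp: l_def)
  have 1: "s - start X r < length l" using assms by (simp add: start_Suc sl)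
  have 2: "asg X (Suc r) s = l ! (s - start X r)" using assms by (simp add: asg_Suc l_def)
  show 3: "asg X (Suc r) s \<in> act X r" using 1 2 sl nth_mem by metis
  have *: "s = pull_time X r (asg X (Suc r) s)"
  proof -
    let ?i = "asg X (Suc r) s"
    have "l ! card {j \<in> act X r. j < ?i} = ?i"
      unfolding l_def by (rule sorted_list_of_set_nth_rank) (use 3 in auto)
    moreover have "card {j \<in> act X r. j < ?i} < length l"
      unfolding sl using 3 by (intro psubset_card_mono) auto
    ultimately have "card {j \<in> act X r. j < ?i} = s - start X r"
      using 1 2 sl(3) by (metis nth_eq_iff_index_eq)
    then show ?thesis using assms by (simp add: pull_time_def)
  qed
  show "asg X (Suc r) s = i \<longleftrightarrow> i \<in> act X r \<and> s = pull_time X r i" (is "?l \<longleftrightarrow> ?r")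
  proof
    assume ?l then show ?r using * 3 by auto
  next
    assume r: ?r
    have "l ! card {j \<in> act X r. j < i} = i"
      unfolding l_def by (rule sorted_list_of_set_nth_rank) (use r in auto)
    then show ?l using r 2 by (simp add: pull_time_def)
  qed
qed

lemma asg_in_arms:
  assumes "1 \<le> s" "s < start X r"
  shows "asg X r s \<in> {..<K}"
  using assms(2)
proof (induction r)
  case (Suc r)
  show ?case
  proof (cases "s < start X r")
    case True
    then show ?thesis using Suc asg_stable[of r "Suc r" s X] by simp
  next
    case False
    then show ?thesis using asg_round(1)[of X r s] Suc act_subset by (auto simp: not_less)
  qed
qed (use assms in simp)

lemma pulls_eq:
  "{s \<in> {1..<start X r}. asg X r s = i} = (\<lambda>q. pull_time X q i) ` {q. q < r \<and> i \<in> act X q}"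
proof (induction r)
  case (Suc r)
  have "{s \<in> {1..<start X (Suc r)}. asg X (Suc r) s = i}
      = {s \<in> {1..<start X r}. asg X r s = i}
        \<union> {s \<in> {start X r..<start X (Suc r)}. asg X (Suc r) s = i}"
    using asg_stable[of r "Suc r" _ X] start_mono[of r "Suc r" X] start_pos[of X r] by auto
  also have "{s \<in> {start X r..<start X (Suc r)}. asg X (Suc r) s = i}
      = {s. s = pull_time X r i \<and> i \<in> act X r}"
    using asg_round(2)[of X r _ i] pull_time_bounds[of i X r] by auto
  also have "{s \<in> {1..<start X r}. asg X r s = i} \<union> \<dots>
      = (\<lambda>q. pull_time X q i) ` {q. q < Suc r \<and> i \<in> act X q}"
    unfolding Suc.IH by (auto simp: less_Suc_eq image_iff)
  finally show ?case .
qed simp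

section \<open>Spacing of the plays of one arm\<close>

lemma pull_time_less:
  assumes "i \<in> act X q" "q < q'"
  shows "pull_time X q i < pull_time X q' i"
  using pull_time_bounds(2)[OF assms(1)] start_mono[of "Suc q" q' X] assms(2)
  by (simp add: pull_time_def)

lemma inj_on_pull_time: "inj_on (\<lambda>q. pull_time X q i) {q. q < r \<and> i \<in> act X q}"
  by (rule inj_onI) (metis (mono_tags, lifting) linorder_neqE_nat mem_Collect_eq order_less_irrefl pull_time_less)

lemma n_cnt_eq: "n_cnt (asg X r) (start X r) i = card {q. q < r \<and> i \<in> act X q}"
  unfolding n_cnt_def pulls_eq by (rule card_image) (rule inj_on_pull_time)

lemma n_cnt_active:
  assumes "i \<in> act X r"
  shows "n_cnt (asg X (Suc r)) (start X (Suc r)) i = Suc r"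
proof -
  have "{q. q < Suc r \<and> i \<in> act X q} = {..<Suc r}"
    using act_antimono[of _ r X] assms unfolding less_Suc_eq_le lessThan_def by fast
  then show ?thesis unfolding n_cnt_eq by simp
qed

text \<open>Between the plays of \<open>i\<close> in consecutive rounds lie the rest of the first
  round, from \<open>i\<close> upwards, and the arms below \<open>i\<close> in the next one. Both
  active sets contain \<open>act X q'\<close>, so each gap is at least its cardinality; the
  induction adds up the gaps.\<close>

lemma pull_time_spacing:
  assumes "i \<in> act X q'" "q \<le> q'"
  shows "pull_time X q i + (q' - q) * card (act X q') \<le> pull_time X q' i"
  using assms(2)
proof (induction q rule: inc_induct)
  case (step n)
  let ?k = "card (act X q')"
  have sub: "act X q' \<subseteq> act X n" "act X q' \<subseteq> act X (Suc n)" "act X (Suc n) \<subseteq> act X n"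
    using act_antimono step by auto
  have "?k = card {j \<in> act X q'. j < i} + card {j \<in> act X q'. \<not> j < i}"
    by (subst card_Un_disjoint[symmetric]) (auto intro: arg_cong[of _ _ card])
  also have "\<dots> \<le> card {j \<in> act X (Suc n). j < i} + card {j \<in> act X n. \<not> j < i}"
    using sub by (intro add_mono card_mono) auto
  finally have k: "?k \<le> card {j \<in> act X (Suc n). j < i} + card {j \<in> act X n. \<not> j < i}" .
  have "card (act X n) = card {j \<in> act X n. j < i} + card {j \<in> act X n. \<not> j < i}"
    by (subst card_Un_disjoint[symmetric]) (auto intro: arg_cong[of _ _ card])
  then have "pull_time X n i + ?k \<le> pull_time X (Suc n) i"
    using k by (simp add: pull_time_def start_Suc)
  moreover have "(q' - n) * ?k = ?k + (q' - Suc n) * ?k"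
    using step by (metis Suc_diff_Suc mult_Suc)
  ultimately show ?case using step by linarith
qed simp

text \<open>By \<open>pull_time_spacing\<close>, the plays after the earliest recent one are at
  least \<open>card (act X r)\<close> steps apart and fit into a window of length \<open>w\<close>;
  the extra 1 is the earliest play itself. The width stays free: it will be \<open>D\<close> for the
  plays outside \<open>F_set\<close>, and a delay value under an expectation.\<close>

lemma card_recent_pulls:
  assumes "i \<in> act X r"
  shows "real (card {s \<in> {1..<start X (Suc r)}. asg X (Suc r) s = i \<and> start X (Suc r) \<le> s + w})
    \<le> real w / real (card (act X r)) + 1"
proof -
  let ?k = "card (act X r)"
  let ?Q = "{q. q < Suc r \<and> i \<in> act X q \<and> start X (Suc r) \<le> pull_time X q i + w}"
  have k: "?k > 0" using assms by (auto simp: card_gt_0_iff)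
  have "{s \<in> {1..<start X (Suc r)}. asg X (Suc r) s = i \<and> start X (Suc r) \<le> s + w}
     = {s \<in> {s \<in> {1..<start X (Suc r)}. asg X (Suc r) s = i}. start X (Suc r) \<le> s + w}" by auto
  also have "\<dots> = (\<lambda>q. pull_time X q i) ` ?Q"
    unfolding pulls_eq by auto
  finally have eq: "card {s \<in> {1..<start X (Suc r)}. asg X (Suc r) s = i \<and> start X (Suc r) \<le> s + w}
     \<le> card ?Q" by (simp add: card_image_le)
  have "real (card ?Q) \<le> real w / real ?k + 1"
  proof (cases "?Q = {}")
    case False
    define q0 where "q0 = Min ?Q"
    have q0: "q0 \<in> ?Q" using False unfolding q0_def by (intro Min_in) auto
    have "?Q \<subseteq> {q0..<Suc r}" unfolding q0_def by (auto intro!: Min_le)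
    then have "card ?Q \<le> Suc r - q0" using card_mono[of "{q0..<Suc r}"] by fastforce
    moreover have "start X (Suc r) + (r - q0) * ?k < start X (Suc r) + w"
      using q0 pull_time_spacing[OF assms, of q0] pull_time_bounds(2)[OF assms] by auto
    then have "(r - q0) * ?k \<le> w" by simp
    then have "real (r - q0) * real ?k \<le> real w"
      by (metis of_nat_le_iff of_nat_mult)
    then have "real (r - q0) \<le> real w / real ?k" using k by (simp add: pos_le_divide_eq)
    moreover have "real (Suc r - q0) = real (r - q0) + 1" using q0 by auto
    ultimately show ?thesis by (smt (verit) of_nat_mono)
  next
    case True
    show ?thesis unfolding True by simp
  qed
  then show ?thesis using eq by linarith
qed

section \<open>Predictability: the arm of a step is determined by earlier delays\<close>

definition pulled :: "nat \<Rightarrow> nat \<Rightarrow> (nat \<times> nat \<Rightarrow> nat) \<Rightarrow> bool" where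
  "pulled i s X \<longleftrightarrow> (\<exists>r. s < start X r \<and> asg X r s = i)"

text \<open>An assigned step is never reassigned, so the round chosen in the definition is
  immaterial. This gives a predicate of step and table, as the selection rule of the tail bounds
  requires.\<close>

lemma pulled_iff: "s < start X r \<Longrightarrow> pulled i s X \<longleftrightarrow> asg X r s = i"
  unfolding pulled_def by (metis asg_stable nat_le_linear)

text \<open>The confidence bounds computed at time \<open>t\<close> consult only table entries of
  steps before \<open>t\<close>. This suffices for predictability, whether or not the feedback of
  those steps has arrived.\<close>

lemma cse_state_cong:
  assumes "\<And>s' j. s' < s \<Longrightarrow> X (s', j) = Y (s', j)" "start X r \<le> s"
  shows "cse_state K T D B X r = cse_state K T D B Y r"
  using assms(2)
proof (induction r)
  case (Suc r)
  then have IH: "start X r = start Y r" "act X r = act Y r" "asg X r = asg Y r"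
    using start_mono[of r "Suc r" X] by (simp_all add: cse_state_eq)
  have t: "start X (Suc r) = start Y (Suc r)" by (simp add: start_Suc IH)
  have a: "asg X (Suc r) = asg Y (Suc r)" unfolding asg_Suc t IH by simp
  have u: "s' < start Y (Suc r) \<Longrightarrow> X (s', j) = Y (s', j)" for s' j
    using assms(1) Suc.prems t by simp
  have "M_set X c (start Y (Suc r)) i = M_set Y c (start Y (Suc r)) i"
    "O_set X c (start Y (Suc r)) i = O_set Y c (start Y (Suc r)) i" for c i
    unfolding M_set_def O_set_def delay_def using u
    by (metis (lifting) atLeastLessThan_iff)+
  moreover have "sum (cost D X c) (O_set Y c (start Y (Suc r)) i) = sum (cost D Y c) (O_set Y c (start Y (Suc r)) i)"
    "sum (cost D X c) (F_set D c (start Y (Suc r)) i) = sum (cost D Y c) (F_set D c (start Y (Suc r)) i)" for c i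
    by (auto simp: O_set_def F_set_def cost_def delay_def u intro!: sum.cong)
  ultimately have "act X (Suc r) = act Y (Suc r)"
    unfolding act_Suc t a IH LCB_def UCB_def mu_minus_hat_def mu_F_hat_def Let_def by simp
  then show ?case using t a by (simp add: cse_state_eq)
qed (simp add: cse_state_def)

lemma pulled_cong:
  assumes "\<And>s' j. s' < s \<Longrightarrow> X (s', j) = Y (s', j)"
  shows "pulled i s X \<longleftrightarrow> pulled i s Y"
proof -
  \<comment> \<open>One direction suffices by symmetry; this also covers tables for which no round
    reaches \<open>s\<close>, where \<open>pulled\<close> is false.\<close>
  have "pulled i s Z" if "pulled i s W" and WZ: "\<And>s' j. s' < s \<Longrightarrow> W (s', j) = Z (s', j)" for W Z
  proof -
    define r where "r = (LEAST r. s < start W r)"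
    have "\<exists>r. s < start W r" using that(1) unfolding pulled_def by blast
    then have r: "s < start W r" unfolding r_def by (rule LeastI_ex)
    have ri: "asg W r s = i" using that(1) r pulled_iff by blast
    show ?thesis
    proof (cases r)
      case 0
      then show ?thesis using r ri pulled_def by (auto intro!: exI[of _ 0])
    next
      case (Suc q)
      \<comment> \<open>Round \<open>q\<close> is the one containing \<open>s\<close>. It starts no
        later than \<open>s\<close>, so its initial state, and with it its order of play, is the
        same for both tables.\<close>
      then have "start W q \<le> s" unfolding r_def by (metis lessI not_less_Least not_less)
      then have st: "start W q = start Z q" "act W q = act Z q" "asg W q = asg Z q"
        using cse_state_cong[of s W Z q] WZ by (simp_all add: cse_state_eq)
      have "start W (Suc q) = start Z (Suc q)" by (simp add: start_Suc st)
      moreover from this have "asg W (Suc q) = asg Z (Suc q)" unfolding asg_Suc st by simp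
      ultimately show ?thesis using r ri Suc unfolding pulled_def by metis
    qed
  qed
  from this[of X Y] this[of Y X] show ?thesis using assms by metis
qed

text \<open>Every exit of the loop (time, failure, fuel) happens after some number \<open>R\<close>
  of unstopped rounds. That the rounds it adds began before \<open>T\<close> later keeps their ends
  below \<open>T + K\<close>.\<close>

lemma cse_loop_state:
  assumes "cse_loop f T D B X (cse_state K T D B X r) = (out, tf, a)" "act X r \<noteq> {}"
  shows "\<exists>R. r \<le> R \<and> R \<le> r + f \<and> tf = start X R \<and> a = asg X R
    \<and> (\<forall>q. r \<le> q \<and> q < R \<longrightarrow> start X q < T)"
  using assms
proof (induction f arbitrary: r)
  case 0
  then show ?case by (auto simp: cse_state_eq intro!: exI[of _ r])
next
  case (Suc f)
  show ?case
  proof (cases "start X r < T \<and> act X (Suc r) \<noteq> {}")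
    case True
    then have "cse_loop f T D B X (cse_state K T D B X (Suc r)) = (out, tf, a)"
      using Suc.prems(1) by (simp add: cse_state_eq cse_round_state)
    from Suc.IH[OF this] True obtain R where "Suc r \<le> R" "R \<le> Suc r + f" "tf = start X R"
      "a = asg X R" "\<forall>q. Suc r \<le> q \<and> q < R \<longrightarrow> start X q < T" by auto
    moreover have "start X q < T" if "r \<le> q" "q < R" for q
      using that True calculation(5) by (cases "q = r") auto
    ultimately show ?thesis by (intro exI[of _ R]) auto
  next
    case False
    show ?thesis
    proof (cases "start X r < T")
      case True
      then have "tf = start X (Suc r)" "a = asg X (Suc r)"
        using False Suc.prems(1) by (simp_all add: cse_state_eq cse_round_state)
      then show ?thesis using True by (intro exI[of _ "Suc r"]) (auto simp: le_less_Suc_eq)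
    next
      case f: False
      then show ?thesis using Suc.prems(1) by (auto simp: cse_state_eq intro!: exI[of _ r])
    qed
  qed
qed

end

section \<open>Concentration\<close>

locale cse_bandit = cse +
  fixes Dist :: "nat \<Rightarrow> nat pmf"
  assumes K_pos: "K \<ge> 1" and D_pos: "D \<ge> 1" and T_ge_2: "T \<ge> 2" and B_pos: "B > 0"
    and supp: "\<And>i. i < K \<Longrightarrow> set_pmf (Dist i) \<subseteq> {0..D}"
begin

abbreviation mu :: "nat \<Rightarrow> real" where "mu \<equiv> mean_cost D Dist"
abbreviation mu_star :: real where "mu_star \<equiv> Min (mean_cost D Dist ` {..<K})"
abbreviation Delta :: "nat \<Rightarrow> real" where "Delta \<equiv> gap K D Dist"
abbreviation L :: real where "L \<equiv> ln (real T)"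
abbreviation steps :: "(nat \<times> nat \<Rightarrow> nat) \<Rightarrow> nat \<Rightarrow> nat \<Rightarrow> nat \<Rightarrow> nat set" where
  "steps X r u i \<equiv> {s \<in> {1..<u}. asg X r s = i}"

section \<open>Elementary bounds on \<open>L\<close>, means and gaps\<close>

lemma L_ge: "L \<ge> 2 / 3"
proof -
  have "ln 2 \<le> L" using T_ge_2 by simp
  then show ?thesis using ln2_ge_two_thirds by linarith
qed

lemma finite_support: "i < K \<Longrightarrow> finite (set_pmf (Dist i))"
  using supp finite_subset by blast

lemma mu_bounds:
  assumes "i < K"
  shows "0 \<le> mu i" "mu i \<le> 1"
proof -
  show "0 \<le> mu i" unfolding mean_cost_def by (intro integral_nonneg_AE) auto
  have "mu i \<le> measure_pmf.expectation (Dist i) (\<lambda>_. 1)"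
    unfolding mean_cost_def using supp[OF assms] D_pos
    by (intro integral_mono_AE integrable_measure_pmf_finite finite_support assms)
       (auto simp: AE_measure_pmf_iff divide_le_eq)
  then show "mu i \<le> 1" by simp
qed

lemma mu_star_le: "i < K \<Longrightarrow> mu_star \<le> mu i"
  by simp

lemma mu_star_attained: obtains b where "b < K" "mu b = mu_star"
proof -
  have "mu_star \<in> mu ` {..<K}" using K_pos by (intro Min_in) (auto simp: lessThan_empty_iff)
  then show ?thesis using that by fastforce
qed

lemma Delta_bounds:
  assumes "i < K"
  shows "0 \<le> Delta i" "Delta i \<le> mu i" "Delta i \<le> 1"
proof -
  have "0 \<le> mu_star" using mu_star_attained mu_bounds(1) by metis
  then show "0 \<le> Delta i" "Delta i \<le> mu i" "Delta i \<le> 1"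
    using mu_star_le[OF assms] mu_bounds[OF assms] by (auto simp: gap_def)
qed

lemma gap_max_nonneg: "0 \<le> gap_max K D Dist"
proof -
  have "Delta 0 \<le> gap_max K D Dist"
    unfolding gap_max_def using K_pos by (intro Max_ge) auto
  then show ?thesis using Delta_bounds(1)[of 0] K_pos by simp
qed

text \<open>Stopping the selection after \<open>n\<close> plays keeps it predictable and makes the number of samples
  deterministic, so the union bound runs over \<open>n\<close> and not over the random times of the rounds.\<close>

definition first_pulls :: "nat \<Rightarrow> nat \<Rightarrow> (nat \<times> nat \<Rightarrow> nat) \<Rightarrow> nat set" where
  "first_pulls i n X =
    {s \<in> {1..<T + K}. pulled i s X \<and> card {s' \<in> {1..<s}. pulled i s' X} < n}"

definition dev :: "(nat \<times> nat \<Rightarrow> nat) \<Rightarrow> nat \<Rightarrow> nat set \<Rightarrow> real" where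
  "dev X i P = (\<Sum>s\<in>P. real (X (s, i)) / real D - mu i)"

text \<open>The equality for the cardinality excludes runs in which the arm is played fewer than
  \<open>n\<close> times. The second part is indexed by time, since being outstanding refers to a
  deadline; half of its \<open>16 L\<close> becomes the \<open>8 ln T\<close> in
  \<open>L3\<close>.\<close>

definition good :: "(nat \<times> nat \<Rightarrow> nat) \<Rightarrow> bool" where
  "good X \<longleftrightarrow>
    (\<forall>i<K. \<forall>n\<in>{1..T}. card (first_pulls i n X) = n
       \<longrightarrow> \<bar>dev X i (first_pulls i n X)\<bar> \<le> sqrt (2 * L * real n)) \<and>
    (\<forall>i<K. \<forall>t\<in>{1..T + K}.
       real (card {s \<in> {1..<t}. pulled i s X \<and> t \<le> s + X (s, i)})
       \<le> 2 * (\<Sum>s\<in>{s \<in> {1..<t}. pulled i s X}. measure_pmf.prob (Dist i) {x. t \<le> s + x}) + 16 * L)"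

section \<open>Tail bounds and the probability of a bad table\<close>

lemma prob_dev_ge:
  assumes "i < K" "n \<ge> 1" and e: "e \<in> {1, - 1 :: real}"
  shows "measure_pmf.prob (delay_table K T Dist)
    {X. card (first_pulls i n X) = n \<and> e * dev X i (first_pulls i n X) > sqrt (2 * L * real n)}
    \<le> exp (- (4 * L))"
proof -
  \<comment> \<open>Up to the sign \<open>e\<close> of the tail, this \<open>l\<close> maximises
    \<open>l * x - n * l^2 / 8\<close> at \<open>x = sqrt (2 * L * n)\<close>; the maximum is
    \<open>8 L - 4 L = 4 L\<close>.\<close>
  define l where "l = e * (4 * sqrt (2 * L / real n))"
  have L: "L > 0" using L_ge by simp
  have l: "l \<noteq> 0" using e L assms(2) by (auto simp: l_def)
  have l2: "real n * l\<^sup>2 / 8 = 4 * L"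
    using e L assms(2) by (auto simp: l_def power_mult_distrib)
  let ?g = "\<lambda>(s::nat) y. l * (real y / real D - mu i) - l\<^sup>2 / 8"
  let ?sel = "\<lambda>s X. pulled i s X \<and> card {s' \<in> {1..<s}. pulled i s' X} < n"
  have tail: "measure_pmf.prob (delay_table K T Dist)
      {X. (\<Sum>s\<in>{s\<in>{1..<T + K}. ?sel s X}. ?g s (X (s, i))) \<ge> 4 * L} \<le> exp (- (4 * L))"
    unfolding delay_table_def
  proof (rule prob_predictable_sum_ge)
    fix s and X Y :: "nat \<times> nat \<Rightarrow> nat" assume eq: "\<And>s' j. s' < s \<Longrightarrow> X (s', j) = Y (s', j)"
    have "pulled i s' X \<longleftrightarrow> pulled i s' Y" if "s' \<le> s" for s'
      using that by (intro pulled_cong eq) simp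
    then have "pulled i s X \<longleftrightarrow> pulled i s Y"
      and "{s' \<in> {1..<s}. pulled i s' X} = {s' \<in> {1..<s}. pulled i s' Y}" by auto
    then show "?sel s X \<longleftrightarrow> ?sel s Y" by simp
  next
    fix s
    show "(\<integral>\<^sup>+y. ennreal (exp (?g s y)) \<partial>(case (s, i) of (s, i) \<Rightarrow> Dist i)) \<le> 1"
    proof -
      have "real x / real D \<in> {0..1}" if "x \<in> set_pmf (Dist i)" for x
        using that supp[OF assms(1)] D_pos by (auto simp: divide_le_eq)
      from nn_integral_exp_Hoeffding_le_1[OF this l] show ?thesis
        by (simp add: mean_cost_def)
    qed
  qed (use assms in auto)
  have sub: "{X. card (first_pulls i n X) = n \<and> e * dev X i (first_pulls i n X) > sqrt (2 * L * real n)}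
     \<subseteq> {X. (\<Sum>s\<in>{s\<in>{1..<T + K}. ?sel s X}. ?g s (X (s, i))) \<ge> 4 * L}"
  proof safe
    fix X assume c: "card (first_pulls i n X) = n"
      and d: "e * dev X i (first_pulls i n X) > sqrt (2 * L * real n)"
    have "(\<Sum>s\<in>{s\<in>{1..<T + K}. ?sel s X}. ?g s (X (s, i)))
        = l * dev X i (first_pulls i n X) - real n * l\<^sup>2 / 8"
    proof -
      have "(\<Sum>s\<in>P. l * h s - v) = l * sum h P - real (card P) * v" for h :: "nat \<Rightarrow> real" and P v
        by (simp add: sum_subtractf sum_distrib_left)
      then show ?thesis unfolding first_pulls_def[symmetric] dev_def using c by simp
    qed
    also have "\<dots> = 4 * sqrt (2 * L / real n) * (e * dev X i (first_pulls i n X)) - 4 * L"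
      unfolding l2 by (simp add: l_def)
    finally have eq: "(\<Sum>s\<in>{s\<in>{1..<T + K}. ?sel s X}. ?g s (X (s, i)))
       = 4 * sqrt (2 * L / real n) * (e * dev X i (first_pulls i n X)) - 4 * L" .
    have "2 * L / real n * (2 * L * real n) = (2 * L)\<^sup>2"
      using assms(2) by (simp add: power2_eq_square)
    then have "sqrt (2 * L / real n) * sqrt (2 * L * real n) = 2 * L"
      unfolding real_sqrt_mult[symmetric] using L by (simp only: real_sqrt_abs abs_of_pos)
    moreover have "sqrt (2 * L / real n) * sqrt (2 * L * real n)
        \<le> sqrt (2 * L / real n) * (e * dev X i (first_pulls i n X))"
      using d L by (intro mult_left_mono) auto
    ultimately show "(\<Sum>s\<in>{s\<in>{1..<T + K}. ?sel s X}. ?g s (X (s, i))) \<ge> 4 * L"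
      unfolding eq by linarith
  qed
  show ?thesis
    by (rule order_trans[OF measure_pmf.finite_measure_mono[OF sub] tail]) simp
qed

text \<open>For a fixed deadline \<open>t\<close>, being outstanding is an event of the single delay
  \<open>X (s, i)\<close>. The sum of its probabilities over the plays is still random; it stays in
  the statement and is estimated for each table by \<open>sum_prob_outstanding_le\<close>.\<close>

lemma prob_outstanding_ge:
  assumes "i < K" "t \<le> T + K"
  shows "measure_pmf.prob (delay_table K T Dist)
    {X. real (card {s \<in> {1..<t}. pulled i s X \<and> t \<le> s + X (s, i)})
       > 2 * (\<Sum>s\<in>{s \<in> {1..<t}. pulled i s X}. measure_pmf.prob (Dist i) {x. t \<le> s + x}) + 16 * L}
    \<le> exp (- (16 * L))"
proof -
  let ?g = "\<lambda>s y. of_bool (y \<in> {x. t \<le> s + x}) - 2 * measure_pmf.prob (Dist i) {x. t \<le> s + x}"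
  have "measure_pmf.prob (delay_table K T Dist)
      {X. (\<Sum>s\<in>{s\<in>{1..<t}. pulled i s X}. ?g s (X (s, i))) \<ge> 16 * L} \<le> exp (- (16 * L))"
    unfolding delay_table_def
  proof (rule prob_predictable_sum_ge)
    show "(\<integral>\<^sup>+y. ennreal (exp (?g s y)) \<partial>(case (s, i) of (s, i) \<Rightarrow> Dist i)) \<le> 1" for s
      using nn_integral_exp_indicator_le_1[where q = "Dist i" and E = "{x. t \<le> s + x}"] by simp
    show "(s, i) \<in> {1..<T + K} \<times> {..<K}" if "s \<in> {1..<t}" for s
      using that assms by auto
  qed (simp, rule pulled_cong)
  moreover have "(\<Sum>s\<in>{s\<in>{1..<t}. pulled i s X}. ?g s (X (s, i)))
     = real (card {s \<in> {1..<t}. pulled i s X \<and> t \<le> s + X (s, i)})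
       - 2 * (\<Sum>s\<in>{s \<in> {1..<t}. pulled i s X}. measure_pmf.prob (Dist i) {x. t \<le> s + x})" for X
  proof -
    have "{s \<in> {1..<t}. pulled i s X \<and> t \<le> s + X (s, i)}
       = {s \<in> {1..<t}. pulled i s X} \<inter> {s. t \<le> s + X (s, i)}" by auto
    then show ?thesis by (simp add: sum_subtractf sum_distrib_left sum_of_bool_eq)
  qed
  ultimately have tail: "measure_pmf.prob (delay_table K T Dist)
      {X. real (card {s \<in> {1..<t}. pulled i s X \<and> t \<le> s + X (s, i)})
       - 2 * (\<Sum>s\<in>{s \<in> {1..<t}. pulled i s X}. measure_pmf.prob (Dist i) {x. t \<le> s + x}) \<ge> 16 * L}
       \<le> exp (- (16 * L))" by simp
  show ?thesis
    by (rule order_trans[OF measure_pmf.finite_measure_mono tail]) auto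
qed

text \<open>The union bound gives \<open>2 K T / T^4 + K (T + K) / T^16\<close>, and
  \<open>K < T\<close> turns this into powers of \<open>T\<close>. The factor \<open>T\<close> is
  included because a bad table may cost up to \<open>T\<close> plays of each arm.\<close>

lemma prob_bad:
  assumes "K < T"
  shows "real T * measure_pmf.prob (delay_table K T Dist) {X. \<not> good X} \<le> 2"
proof -
  let ?P = "measure_pmf.prob (delay_table K T Dist)"
  define U where "U e = {X. \<exists>x\<in>{..<K} \<times> {1..T}.
      card (first_pulls (fst x) (snd x) X) = snd x
      \<and> e * dev X (fst x) (first_pulls (fst x) (snd x) X) > sqrt (2 * L * real (snd x))}" for e :: real
  define V where "V = {X. \<exists>x\<in>{..<K} \<times> {1..T + K}.
      real (card {s \<in> {1..<snd x}. pulled (fst x) s X \<and> snd x \<le> s + X (s, fst x)})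
       > 2 * (\<Sum>s\<in>{s \<in> {1..<snd x}. pulled (fst x) s X}.
           measure_pmf.prob (Dist (fst x)) {y. snd x \<le> s + y}) + 16 * L}"
  have exp_L: "exp (- (real m * L)) = 1 / real T ^ m" for m
    using T_ge_2 by (simp add: exp_minus exp_of_nat_mult inverse_eq_divide)
  have U: "?P (U e) \<le> real (K * T) * (1 / real T ^ 4)" if "e \<in> {1, - 1}" for e
  proof -
    have "?P (U e) \<le> real (card ({..<K} \<times> {1..T})) * exp (- (4 * L))"
      unfolding U_def by (rule prob_Bex_le, simp, rule prob_dev_ge[OF _ _ that]) auto
    then show ?thesis using exp_L[of 4] by (simp add: card_cartesian_product)
  qed
  have V: "?P V \<le> real (K * (T + K)) * (1 / real T ^ 16)"
  proof -
    have "?P V \<le> real (card ({..<K} \<times> {1..T + K})) * exp (- (16 * L))"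
      unfolding V_def by (rule prob_Bex_le, simp, rule prob_outstanding_ge) auto
    then show ?thesis using exp_L[of 16] by (simp add: card_cartesian_product)
  qed
  have "{X. \<not> good X} \<subseteq> U 1 \<union> U (- 1) \<union> V"
  proof
    fix X assume "X \<in> {X. \<not> good X}"
    then consider i n where "i < K" "n \<in> {1..T}" "card (first_pulls i n X) = n"
        "\<bar>dev X i (first_pulls i n X)\<bar> > sqrt (2 * L * real n)"
      | i t where "i < K" "t \<in> {1..T + K}"
        "real (card {s \<in> {1..<t}. pulled i s X \<and> t \<le> s + X (s, i)})
         > 2 * (\<Sum>s\<in>{s \<in> {1..<t}. pulled i s X}. measure_pmf.prob (Dist i) {x. t \<le> s + x}) + 16 * L"
      unfolding good_def mem_Collect_eq not_less[symmetric] by blast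
    then show "X \<in> U 1 \<union> U (- 1) \<union> V"
    proof cases
      case (1 i n)
      have "X \<in> U e" if "e * dev X i (first_pulls i n X) > sqrt (2 * L * real n)" for e
        unfolding U_def using 1(1-3) that by (intro CollectI bexI[of _ "(i, n)"]) simp_all
      moreover have "1 * dev X i (first_pulls i n X) > sqrt (2 * L * real n)
          \<or> - 1 * dev X i (first_pulls i n X) > sqrt (2 * L * real n)" using 1(4) by linarith
      ultimately show ?thesis by blast
    next
      case (2 i t)
      then have "X \<in> V" unfolding V_def using 2 by (intro CollectI bexI[of _ "(i, t)"]) simp_all
      then show ?thesis by simp
    qed
  qed
  then have "?P {X. \<not> good X} \<le> ?P (U 1 \<union> U (- 1) \<union> V)"
    by (intro measure_pmf.finite_measure_mono) auto
  also have "\<dots> \<le> ?P (U 1) + ?P (U (- 1)) + ?P V"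
    by (rule order_trans[OF measure_Un_le add_right_mono[OF measure_Un_le]]) auto
  also have "\<dots> \<le> 2 * (real (K * T) * (1 / real T ^ 4)) + real (K * (T + K)) * (1 / real T ^ 16)"
    using U[of 1] U[of "- 1"] V by simp
  also have "\<dots> \<le> 2 * (real (T * T) * (1 / real T ^ 4)) + real (T * (T + T)) * (1 / real T ^ 16)"
    using assms by (intro add_mono mult_left_mono mult_right_mono of_nat_mono mult_le_mono) auto
  finally have "real T * ?P {X. \<not> good X}
     \<le> real T * (2 * (real (T * T) * (1 / real T ^ 4)) + real (T * (T + T)) * (1 / real T ^ 16))"
    by (rule mult_left_mono) simp
  also have "\<dots> = 2 / real T + 2 / real T ^ 13"
  proof -
    have "x * (2 * (x * x * (1 / x ^ 4)) + x * (x + x) * (1 / x ^ 16)) = 2 / x + 2 / x ^ 13"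
      if "x \<noteq> 0" for x :: real
    proof -
      define y where "y = x ^ 13"
      have "x ^ 4 = x * x * x * x" by (simp add: power4_eq_xxxx)
      moreover have "x ^ 16 = y * (x * x * x)"
        using power_add[of x 13 3] by (simp add: y_def power3_eq_cube)
      moreover have "y \<noteq> 0" using that by (simp add: y_def)
      ultimately show ?thesis using that unfolding y_def[symmetric] by (simp add: field_simps)
    qed
    from this[of "real T"] show ?thesis using T_ge_2 by simp
  qed
  also have "\<dots> \<le> 1 + 1"
  proof (intro add_mono)
    have "real T ^ 1 \<le> real T ^ 13" using T_ge_2 by (intro power_increasing) auto
    moreover have "2 \<le> real T" using T_ge_2 by simp
    ultimately have "2 \<le> real T ^ 13" by (simp only: power_one_right)
    then show "2 / real T ^ 13 \<le> 1" using T_ge_2 by (subst divide_le_eq_1_pos) simp_all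
  qed (use T_ge_2 in simp)
  finally show ?thesis by simp
qed

subsection \<open>Validity of the confidence bounds\<close>

text \<open>If \<open>n\<close> plays of \<open>i\<close> occur before \<open>u\<close>, they are
  exactly its first \<open>n\<close> plays, since a play at or after \<open>u\<close> already has
  \<open>n\<close> predecessors. An arm is played at most once per round, so
  \<open>n <= r <= T\<close> lies in the range of the union bound.\<close>

lemma dev_steps_le:
  assumes "good X" "i < K" "r \<le> T" "start X r \<le> T + K" "u \<le> start X r"
  shows "\<bar>dev X i (steps X r u i)\<bar> \<le> sqrt (2 * L * real (card (steps X r u i)))"
proof (cases "steps X r u i = {}")
  case True
  then show ?thesis unfolding True by (simp add: dev_def)
next
  case False
  let ?P = "steps X r u i"
  define n where "n = card ?P"
  have fin: "finite ?P" by simp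
  have n1: "n \<ge> 1" using False fin unfolding n_def by (metis One_nat_def Suc_leI card_gt_0_iff)
  have "n \<le> n_cnt (asg X r) (start X r) i"
    unfolding n_def n_cnt_def using assms(5) by (intro card_mono) auto
  also have "\<dots> \<le> card {..<r}" unfolding n_cnt_eq by (intro card_mono) auto
  finally have nT: "n \<in> {1..T}" using n1 assms(3) by simp
  have pulled: "pulled i s X \<longleftrightarrow> asg X r s = i" if "s < u" for s
    using pulled_iff that assms(5) by simp
  have FP: "first_pulls i n X = ?P"
  proof (intro equalityI subsetI)
    fix s assume s: "s \<in> first_pulls i n X"
    have "s < u"
    proof (rule ccontr)
      assume "\<not> s < u"
      then have "?P \<subseteq> {s' \<in> {1..<s}. pulled i s' X}" using pulled by auto
      then have "n \<le> card {s' \<in> {1..<s}. pulled i s' X}" unfolding n_def by (intro card_mono) auto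
      then show False using s by (simp add: first_pulls_def)
    qed
    then show "s \<in> ?P" using s pulled by (auto simp: first_pulls_def)
  next
    fix s assume s: "s \<in> ?P"
    have "{s' \<in> {1..<s}. pulled i s' X} \<subset> ?P" using s pulled by auto
    then have "card {s' \<in> {1..<s}. pulled i s' X} < n"
      unfolding n_def using fin by (rule psubset_card_mono[rotated])
    then show "s \<in> first_pulls i n X"
      using s pulled assms(4,5) by (auto simp: first_pulls_def)
  qed
  have "card (first_pulls i n X) = n" unfolding FP by (simp only: n_def)
  then have "\<bar>dev X i (first_pulls i n X)\<bar> \<le> sqrt (2 * L * real n)"
    using assms(1)[unfolded good_def, THEN conjunct1] assms(2) nT by blast
  then show ?thesis unfolding FP by (simp only: n_def)
qed

text \<open>\<open>s + D <= t\<close> means \<open>s < t + 1 - D\<close>, also under truncated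
  subtraction. Thus \<open>F_set\<close> is an initial segment of the plays, to which
  \<open>dev_steps_le\<close> applies.\<close>

lemma F_set_eq: "F_set D (asg X r) (start X r) i = steps X r (start X r + 1 - D) i"
  using D_pos by (auto simp: F_set_def)

abbreviation f_cnt :: "(nat \<times> nat \<Rightarrow> nat) \<Rightarrow> nat \<Rightarrow> nat \<Rightarrow> nat" where
  "f_cnt X r i \<equiv> max (card (F_set D (asg X r) (start X r) i)) 1"

lemma mu_F_hat_accurate:
  assumes "good X" "i < K" "r \<le> T" "start X r \<le> T + K"
  shows "\<bar>mu_F_hat D X (asg X r) (start X r) i - mu i\<bar> \<le> sqrt (2 * L / real (f_cnt X r i))"
proof (cases "F_set D (asg X r) (start X r) i = {}")
  case True
  \<comment> \<open>Without samples the estimate is 0 and the radius \<open>sqrt (2 * L)\<close>,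
    which exceeds every mean because \<open>T >= 2\<close>.\<close>
  have "1 \<le> sqrt (2 * L)" using L_ge by simp
  then have "\<bar>0 - mu i\<bar> \<le> sqrt (2 * L)" using mu_bounds[OF assms(2)] by linarith
  then show ?thesis unfolding mu_F_hat_def True by simp
next
  case False
  let ?F = "F_set D (asg X r) (start X r) i"
  have fin: "finite ?F" unfolding F_set_eq by simp
  then have pos: "card ?F > 0" using False by (simp add: card_gt_0_iff)
  have "(\<Sum>s\<in>?F. cost D X (asg X r) s) = (\<Sum>s\<in>?F. real (X (s, i)) / real D)"
    by (intro sum.cong) (auto simp: F_set_def cost_def delay_def)
  then have "mu_F_hat D X (asg X r) (start X r) i - mu i = dev X i ?F / real (card ?F)"
    using pos by (simp add: mu_F_hat_def dev_def sum_subtractf max_absorb1 diff_divide_distrib)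
  moreover have "\<bar>dev X i ?F\<bar> \<le> sqrt (2 * L * real (card ?F))"
    unfolding F_set_eq using D_pos by (intro dev_steps_le assms) simp
  ultimately have "\<bar>mu_F_hat D X (asg X r) (start X r) i - mu i\<bar> \<le> sqrt (2 * L * real (card ?F)) / real (card ?F)"
    using pos by (simp add: divide_right_mono)
  also have "\<dots> = sqrt (2 * L / real (card ?F))"
    using pos by (intro sqrt_mult_divide_self) simp
  also have "real (card ?F) = real (f_cnt X r i)" using pos by (simp add: max_def)
  finally show ?thesis .
qed

lemma mu_le_UCB:
  assumes "good X" "i < K" "r \<le> T" "start X r \<le> T + K"
  shows "mu i \<le> UCB T D X (asg X r) (start X r) i"
    and "UCB T D X (asg X r) (start X r) i \<le> mu i + 2 * sqrt (2 * L / real (f_cnt X r i))"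
  using mu_F_hat_accurate[OF assms] unfolding UCB_def by linarith+

text \<open>For an outstanding play the elapsed time underestimates the delay, by at most 1 in terms
  of cost. Hence the upper bound has no error beyond the deviation, while the lower bound loses at
  most \<open>m / n\<close>.\<close>

lemma mu_minus_hat_bounds:
  fixes X :: "nat \<times> nat \<Rightarrow> nat"
  assumes "good X" "\<And>s. X (s, i) \<le> D" "i \<in> act X r" "Suc r \<le> T" "start X (Suc r) \<le> T + K"
  defines "w \<equiv> sqrt (2 * L / real (Suc r))"
    and "m \<equiv> card (M_set X (asg X (Suc r)) (start X (Suc r)) i)"
  shows "mu_minus_hat D X (asg X (Suc r)) (start X (Suc r)) i \<le> mu i + w"
    and "mu_minus_hat D X (asg X (Suc r)) (start X (Suc r)) i \<ge> mu i - w - real m / real (Suc r)"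
proof -
  let ?a = "asg X (Suc r)" and ?t = "start X (Suc r)"
  let ?P = "steps X (Suc r) ?t i" and ?M = "M_set X ?a ?t i" and ?O = "O_set X ?a ?t i"
  have i: "i < K" using assms(3) act_subset by auto
  have cP: "card ?P = Suc r" using n_cnt_active[OF assms(3)] by (simp add: n_cnt_def)
  have P: "?P = ?M \<union> ?O" "?M \<inter> ?O = {}" "finite ?M" "finite ?O"
    by (auto simp: M_set_def O_set_def)
  have dev: "\<bar>dev X i ?P\<bar> \<le> sqrt (2 * L * real (Suc r))"
    using dev_steps_le[OF assms(1) i assms(4,5), of ?t] unfolding cP by simp
  have w: "sqrt (2 * L * real (Suc r)) / real (Suc r) = w"
    unfolding w_def by (intro sqrt_mult_divide_self) simp
  let ?c = "\<lambda>s. real (X (s, i)) / real D"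
  have dev_eq: "dev X i ?P = (\<Sum>s\<in>?M. ?c s) + (\<Sum>s\<in>?O. ?c s) - real (Suc r) * mu i"
    unfolding dev_def sum_subtractf using P cP by (simp add: sum.union_disjoint)
  have O: "(\<Sum>s\<in>?O. cost D X ?a s) = (\<Sum>s\<in>?O. ?c s)"
    by (intro sum.cong) (auto simp: O_set_def cost_def delay_def)
  have M1: "(\<Sum>s\<in>?M. (real ?t - real s) / real D) \<le> (\<Sum>s\<in>?M. ?c s)"
    using D_pos by (intro sum_mono divide_right_mono) (auto simp: M_set_def delay_def)
  have "(\<Sum>s\<in>?M. ?c s - 1) \<le> (\<Sum>s\<in>?M. (real ?t - real s) / real D)"
  proof (rule sum_mono)
    fix s assume "s \<in> ?M"
    then have "s < ?t" by (auto simp: M_set_def)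
    then have "0 \<le> (real ?t - real s) / real D" by simp
    moreover have "?c s \<le> 1" using assms(2)[of s] D_pos by (simp add: divide_le_eq)
    ultimately show "?c s - 1 \<le> (real ?t - real s) / real D" by linarith
  qed
  then have M2: "(\<Sum>s\<in>?M. ?c s) - real m \<le> (\<Sum>s\<in>?M. (real ?t - real s) / real D)"
    by (simp add: sum_subtractf m_def)
  have hat: "mu_minus_hat D X ?a ?t i
      = ((\<Sum>s\<in>?M. (real ?t - real s) / real D) + (\<Sum>s\<in>?O. ?c s)) / real (Suc r)"
    unfolding mu_minus_hat_def n_cnt_active[OF assms(3)] O by simp
  have "mu_minus_hat D X ?a ?t i \<le> (real (Suc r) * mu i + sqrt (2 * L * real (Suc r))) / real (Suc r)"
    unfolding hat by (intro divide_right_mono) (use M1 dev dev_eq in linarith, simp)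
  then show "mu_minus_hat D X ?a ?t i \<le> mu i + w"
    unfolding add_divide_distrib w by simp
  have "(real (Suc r) * mu i - sqrt (2 * L * real (Suc r)) - real m) / real (Suc r) \<le> mu_minus_hat D X ?a ?t i"
    unfolding hat by (intro divide_right_mono) (use M2 dev dev_eq in linarith, simp)
  then show "mu_minus_hat D X ?a ?t i \<ge> mu i - w - real m / real (Suc r)"
    unfolding diff_divide_distrib w by simp
qed

text \<open>Exchange sum and expectation: for a fixed delay \<open>x\<close>, the plays with
  \<open>t <= s + x\<close> are those of the last \<open>x\<close> steps, counted by
  \<open>card_recent_pulls\<close> as at most \<open>x / k + 1\<close>.\<close>

lemma sum_prob_outstanding_le:
  assumes "i \<in> act X r"
  shows "(\<Sum>s\<in>steps X (Suc r) (start X (Suc r)) i. measure_pmf.prob (Dist i) {x. start X (Suc r) \<le> s + x})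
    \<le> real D * mu i / real (card (act X r)) + 1"
proof -
  let ?t = "start X (Suc r)" and ?P = "steps X (Suc r) (start X (Suc r)) i"
  let ?k = "real (card (act X r))"
  have i: "i < K" using assms act_subset by auto
  note int = integrable_measure_pmf_finite[OF finite_support[OF i]]
  have "(\<Sum>s\<in>?P. measure_pmf.prob (Dist i) {x. ?t \<le> s + x})
     = (\<Sum>s\<in>?P. measure_pmf.expectation (Dist i) (indicator {x. ?t \<le> s + x}))" by simp
  also have "\<dots> = measure_pmf.expectation (Dist i) (\<lambda>x. \<Sum>s\<in>?P. indicator {x. ?t \<le> s + x} x)"
    by (rule Bochner_Integration.integral_sum[symmetric]) (rule int)
  also have "\<dots> \<le> measure_pmf.expectation (Dist i) (\<lambda>x. real D / ?k * (real x / real D) + 1)"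
  proof (intro integral_mono int)
    fix x
    have "(\<Sum>s\<in>?P. indicator {x. ?t \<le> s + x} x) = real (card (?P \<inter> {s. ?t \<le> s + x}))"
      by (simp add: indicator_def of_bool_def[symmetric] sum_of_bool_eq)
    also have "?P \<inter> {s. ?t \<le> s + x} = {s \<in> {1..<?t}. asg X (Suc r) s = i \<and> ?t \<le> s + x}" by auto
    also have "real (card \<dots>) \<le> real x / ?k + 1" by (rule card_recent_pulls[OF assms])
    finally show "(\<Sum>s\<in>?P. indicator {x. ?t \<le> s + x} x) \<le> real D / ?k * (real x / real D) + 1"
      using D_pos by simp
  qed
  also have "\<dots> = real D / ?k * mu i + 1"
    unfolding mean_cost_def by (subst Bochner_Integration.integral_add[OF int int]) simp
  finally show ?thesis by simp
qed

lemma LCB_le_mu: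
  assumes "good X" "\<And>s. X (s, i) \<le> D" "i \<in> act X r" "Suc r \<le> T" "start X (Suc r) \<le> T + K"
  shows "LCB T D X (asg X (Suc r)) (act X r) (start X (Suc r)) i \<le> mu i"
proof -
  let ?a = "asg X (Suc r)" and ?t = "start X (Suc r)" and ?k = "real (card (act X r))"
  let ?m = "real (card (M_set X ?a ?t i))"
  have i: "i < K" using assms(3) act_subset by auto
  have k: "?k > 0" using assms(3) by (auto simp: card_gt_0_iff)
  have eq1: "{s \<in> {1..<?t}. pulled i s X} = steps X (Suc r) ?t i"
    using pulled_iff[of _ X "Suc r"] by auto
  have eq2: "{s \<in> {1..<?t}. pulled i s X \<and> ?t \<le> s + X (s, i)} = M_set X ?a ?t i"
    using pulled_iff[of _ X "Suc r"] by (auto simp: M_set_def delay_def)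
  have "?t \<in> {1..T + K}" using assms(5) start_pos by simp
  then have "?m \<le> 2 * (\<Sum>s\<in>steps X (Suc r) ?t i. measure_pmf.prob (Dist i) {x. ?t \<le> s + x}) + 16 * L"
    using assms(1)[unfolded good_def, THEN conjunct2] i unfolding eq1[symmetric] eq2[symmetric] by blast
  \<comment> \<open>The offset \<open>8 ln T + 1\<close> in \<open>L3\<close> is calibrated for
    this: it absorbs half of the deviation \<open>16 L\<close> and the 1 from counting recent
    plays.\<close>
  then have m: "?m / 2 - 8 * L - 1 \<le> real D * mu i / ?k"
    using sum_prob_outstanding_le[OF assms(3)] by linarith
  have "?k / real D * (?m / 2 - 8 * L - 1) \<le> ?k / real D * (real D * mu i / ?k)"
    by (rule mult_left_mono[OF m]) simp
  also have "\<dots> = mu i"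
  proof -
    have "a / d * (d * c / a) = c" if "a > 0" "d > 0" for a c d :: real using that by simp
    note cancel = this
    show ?thesis by (rule cancel[OF k]) (use D_pos in simp)
  qed
  finally have "?k / real D * (?m / 2 - 8 * L - 1) \<le> mu i" .
  moreover note mu_minus_hat_bounds(1)[OF assms] mu_F_hat_accurate[OF assms(1) i assms(4,5)]
  ultimately show ?thesis
    unfolding LCB_def Let_def n_cnt_active[OF assms(3)] by (simp add: abs_le_iff algebra_simps)
qed

lemma survivor:
  assumes "i \<in> act X (Suc r)" "j \<in> act X r"
  shows "LCB T D X (asg X (Suc r)) (act X r) (start X (Suc r)) i
      \<le> min (UCB T D X (asg X (Suc r)) (start X (Suc r)) j) B"
  using assms unfolding act_Suc by auto

text \<open>When \<open>B < \<mu>\<^sup>*\<close> the optimal arm may be eliminated before the others, but then \<open>B\<close> itself is an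
  elimination threshold at least as strong as the upper confidence bound of that arm.\<close>

lemma optimal_arm_lost:
  fixes X :: "nat \<times> nat \<Rightarrow> nat"
  assumes "good X" "\<And>s i. i < K \<Longrightarrow> X (s, i) \<le> D" "b < K" "mu b = mu_star"
    and "b \<notin> act X r" "r \<le> T" "start X r \<le> T + K"
  shows "B < mu_star"
  using assms(5-)
proof (induction r)
  case (Suc r)
  show ?case
  proof (cases "b \<in> act X r")
    case True
    then obtain j where j: "j \<in> act X r"
      and lt: "min (UCB T D X (asg X (Suc r)) (start X (Suc r)) j) B
        < LCB T D X (asg X (Suc r)) (act X r) (start X (Suc r)) b"
      using Suc.prems(1) unfolding act_Suc by blast
    have "j < K" using j act_subset by auto
    \<comment> \<open>No upper confidence bound lies below \<open>mu_star\<close>, and the lower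
      bound of \<open>b\<close> does not exceed it, so only \<open>B\<close> can have triggered the
      elimination.\<close>
    then have "mu_star \<le> UCB T D X (asg X (Suc r)) (start X (Suc r)) j"
      using mu_le_UCB(1)[OF assms(1) _ Suc.prems(2,3)] mu_star_le order_trans by blast
    moreover have "LCB T D X (asg X (Suc r)) (act X r) (start X (Suc r)) b \<le> mu_star"
      using LCB_le_mu[OF assms(1) assms(2)[OF assms(3)] True Suc.prems(2,3)] assms(4) by simp
    ultimately show ?thesis using lt by linarith
  next
    case False
    then show ?thesis using Suc start_mono[of r "Suc r" X] by simp
  qed
qed (use assms in simp)

subsection \<open>Regret\<close>

lemma rounds_le_card_F_set:
  fixes X :: "nat \<times> nat \<Rightarrow> nat"
  assumes "i \<in> act X r"
  shows "real (Suc r) \<le> real (card (F_set D (asg X (Suc r)) (start X (Suc r)) i))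
    + real D / real (card (act X r)) + 1"
proof -
  let ?t = "start X (Suc r)"
  let ?R = "{s \<in> {1..<?t}. asg X (Suc r) s = i \<and> ?t \<le> s + D}"
  have "Suc r = card (steps X (Suc r) ?t i)"
    using n_cnt_active[OF assms] by (simp add: n_cnt_def)
  also have "\<dots> \<le> card (F_set D (asg X (Suc r)) ?t i \<union> ?R)"
    by (intro card_mono) (auto simp: F_set_def)
  also have "\<dots> \<le> card (F_set D (asg X (Suc r)) ?t i) + card ?R" by (rule card_Un_le)
  finally have "real (Suc r) \<le> real (card (F_set D (asg X (Suc r)) ?t i)) + real (card ?R)"
    by (simp only: of_nat_add[symmetric] of_nat_le_iff)
  then show ?thesis using card_recent_pulls[OF assms, of D] by linarith
qed

text \<open>The play of \<open>j\<close> in round \<open>p\<close> precedes that of \<open>i\<close>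
  in round \<open>p + 1\<close>, so an old play of \<open>i\<close> is matched with an old play of
  \<open>j\<close> one round earlier. Only round 0 stays unmatched.\<close>

lemma card_F_set_balanced:
  fixes X :: "nat \<times> nat \<Rightarrow> nat"
  assumes "i \<in> act X r" "j \<in> act X r"
  shows "card (F_set D (asg X (Suc r)) (start X (Suc r)) i)
    \<le> card (F_set D (asg X (Suc r)) (start X (Suc r)) j) + 1"
proof -
  let ?t = "start X (Suc r)"
  let ?Q = "\<lambda>i. {q. q < Suc r \<and> i \<in> act X q \<and> pull_time X q i + D \<le> ?t}"
  have F: "card (F_set D (asg X (Suc r)) ?t i) = card (?Q i)" for i
  proof -
    have "F_set D (asg X (Suc r)) ?t i = {s \<in> steps X (Suc r) ?t i. s + D \<le> ?t}"
      by (auto simp: F_set_def)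
    also have "\<dots> = (\<lambda>q. pull_time X q i) ` ?Q i" unfolding pulls_eq by auto
    finally show ?thesis
      using card_image[OF inj_on_subset[OF inj_on_pull_time[of X i "Suc r"], of "?Q i"]] by auto
  qed
  have "?Q i \<subseteq> insert 0 (Suc ` ?Q j)"
  proof
    fix q assume q: "q \<in> ?Q i"
    show "q \<in> insert 0 (Suc ` ?Q j)"
    proof (cases q)
      case (Suc p)
      have "p \<le> r" using q Suc by simp
      then have "j \<in> act X p" using act_antimono assms(2) by blast
      moreover from this have "pull_time X p j \<le> pull_time X q i"
        using pull_time_bounds(2)[of j X p] Suc by (simp add: pull_time_def)
      ultimately have "p \<in> ?Q j" using q Suc by auto
      then show ?thesis using Suc by blast
    qed simp
  qed
  then have "card (?Q i) \<le> card (insert 0 (Suc ` ?Q j))" by (intro card_mono) auto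
  also have "\<dots> \<le> card (?Q j) + 1"
    by (simp add: card_insert_if card_image)
  finally show ?thesis unfolding F .
qed

lemma mult_le_of_le_sqrt:
  assumes "x > 0" "d > 0" "d \<le> 4 * sqrt (2 * L / x)"
  shows "d * x \<le> 32 * L / d"
proof -
  have "d\<^sup>2 \<le> (4 * sqrt (2 * L / x))\<^sup>2" using assms by (intro power_mono) auto
  also have "\<dots> = 32 * L / x" using assms L_ge by (simp add: power_mult_distrib)
  finally show ?thesis using assms by (simp add: field_simps power2_eq_square)
qed

section \<open>Plays of a single surviving suboptimal arm\<close>

context
  fixes X :: "nat \<times> nat \<Rightarrow> nat" and i r :: nat
  assumes good: "good X" and X_le: "\<And>s i. i < K \<Longrightarrow> X (s, i) \<le> D"
    and surv: "i \<in> act X (Suc r)" and r_le: "Suc r \<le> T" and start_le: "start X (Suc r) \<le> T + K"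
    and gap_pos: "Delta i > 0"
begin

lemma i_act: "i \<in> act X r" and i_less: "i < K"
  using surv act_antimono[of r "Suc r" X] act_subset by auto

lemma card_act_pos: "real (card (act X r)) > 0"
  using i_act by (auto simp: card_gt_0_iff)

text \<open>Passing the test after round \<open>r\<close> allows one more play, hence
  \<open>r + 2\<close>. The best arm, if still active, has at least \<open>f - 1\<close> old plays,
  so one width with \<open>f - 1\<close> serves both arms and \<open>Delta i\<close> is at most four
  widths. The \<open>3 * Delta i\<close> pays for the extra play, for the 1 in
  \<open>rounds_le_card_F_set\<close>, and for replacing \<open>f\<close> by
  \<open>f - 1\<close>.\<close>

lemma pulls_le_by_F:
  "Delta i * real (r + 2) \<le> 32 * L / Delta i + 3 * Delta i + real D * Delta i / real (card (act X r))"
proof -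
  define f where "f = card (F_set D (asg X (Suc r)) (start X (Suc r)) i)"
  have "real (r + 2) \<le> real f + real D / real (card (act X r)) + 2"
    using rounds_le_card_F_set[OF i_act] unfolding f_def by simp
  then have "Delta i * real (r + 2) \<le> Delta i * (real f + real D / real (card (act X r)) + 2)"
    using gap_pos by (intro mult_left_mono) auto
  also have "\<dots> = Delta i * (real f - 1) + 3 * Delta i + real D * Delta i / real (card (act X r))"
    by (simp add: algebra_simps)
  also have "Delta i * (real f - 1) \<le> 32 * L / Delta i"
  proof (cases "f \<ge> 2")
    case True
    obtain b where b: "b < K" "mu b = mu_star" by (rule mu_star_attained)
    let ?lcb = "LCB T D X (asg X (Suc r)) (act X r) (start X (Suc r)) i"
    let ?w = "sqrt (2 * L / (real f - 1))"
    have w_i: "sqrt (2 * L / real (f_cnt X (Suc r) i)) \<le> ?w"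
      using True L_ge unfolding f_def[symmetric]
      by (intro real_sqrt_le_mono divide_left_mono) auto
    have "mu_F_hat D X (asg X (Suc r)) (start X (Suc r)) i - sqrt (2 * L / real (f_cnt X (Suc r) i)) \<le> ?lcb"
      unfolding LCB_def Let_def by linarith
    then have lcb: "mu i - 2 * ?w \<le> ?lcb"
      using mu_F_hat_accurate[OF good i_less r_le start_le] w_i by linarith
    have "?lcb \<le> mu_star + 2 * ?w"
    proof (cases "b \<in> act X r")
      case True
      let ?g = "f_cnt X (Suc r) b"
      have "real f - 1 \<le> real ?g" using card_F_set_balanced[OF i_act True] unfolding f_def by simp
      then have "sqrt (2 * L / real ?g) \<le> ?w"
        using \<open>f \<ge> 2\<close> L_ge by (intro real_sqrt_le_mono divide_left_mono) auto
      then show ?thesis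
        using survivor[OF surv True] mu_le_UCB(2)[OF good b(1) r_le start_le] b(2) by linarith
    next
      case False
      then have "B < mu_star"
        using optimal_arm_lost[OF good X_le b False] r_le start_le start_mono[of r "Suc r" X] by simp
      moreover have "0 \<le> ?w" using True L_ge by simp
      ultimately show ?thesis using survivor[OF surv i_act] by linarith
    qed
    then have "Delta i \<le> 4 * ?w" using lcb by (simp add: gap_def)
    then show ?thesis using True gap_pos by (intro mult_le_of_le_sqrt) auto
  next
    case False
    then have "Delta i * (real f - 1) \<le> 0" using gap_pos by (intro mult_nonneg_nonpos) auto
    also have "0 \<le> 32 * L / Delta i" using gap_pos L_ge by simp
    finally show ?thesis .
  qed
  finally show ?thesis by simp
qed

lemma pulls_le_by_outstanding:
  assumes "B < mu i / 3"
  shows "mu i * real (Suc r) \<le> 384 / 5 * L / mu i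
    + 16 / 5 * (B * real D / real (card (act X r)) + 8 * L + 1)"
proof -
  let ?n = "real (Suc r)" and ?k = "real (card (act X r))"
  define m where "m = real (card (M_set X (asg X (Suc r)) (start X (Suc r)) i))"
  let ?lcb = "LCB T D X (asg X (Suc r)) (act X r) (start X (Suc r)) i"
  have mu: "mu i > 0" using assms B_pos by linarith
  have lcb: "?lcb \<le> B" using survivor[OF surv i_act] by simp
  have "?k / real D * (m / 2 - 8 * L - 1) \<le> B"
    using lcb unfolding LCB_def Let_def m_def by linarith
  then have "real D / ?k * (?k / real D * (m / 2 - 8 * L - 1)) \<le> real D / ?k * B"
    by (rule mult_left_mono) simp
  moreover have "real D / ?k * (?k / real D * x) = x" for x
  proof -
    have cancel: "d / k * (k / d * x) = x" if "k > 0" "d > 0" for k d :: real using that by simp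
    show ?thesis by (rule cancel[OF card_act_pos]) (use D_pos in simp)
  qed
  ultimately have m: "m \<le> 2 * (B * real D / ?k + 8 * L + 1)" by (simp add: mult.commute)
  have "mu_minus_hat D X (asg X (Suc r)) (start X (Suc r)) i - sqrt (2 * L / ?n) \<le> B"
    using lcb unfolding LCB_def Let_def n_cnt_active[OF i_act] by linarith
  then have "mu i - 2 * sqrt (2 * L / ?n) - m / ?n \<le> mu i / 3"
    using mu_minus_hat_bounds(2)[OF good X_le[OF i_less] i_act r_le start_le] assms
    unfolding m_def by linarith
  then have "2 / 3 * mu i \<le> 2 * sqrt (2 * L / ?n) + m / ?n" by linarith
  then have "?n * (2 / 3 * mu i) \<le> ?n * (2 * sqrt (2 * L / ?n) + m / ?n)"
    by (rule mult_left_mono) simp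
  also have "\<dots> = 2 * (?n * sqrt (2 * L / ?n)) + m" by (simp add: distrib_left)
  also have "?n * sqrt (2 * L / ?n) = sqrt (2 * L * ?n)"
    using sqrt_mult_divide_self[of ?n "2 * L"] by (simp add: field_simps)
  \<comment> \<open>The weight 1/24 leaves \<open>2/3 - 1/24 = 5/8\<close> of
    \<open>mu i * n\<close> on the left. Dividing by it turns 48 into 384/5 and the factor 2 in the
    bound on \<open>m\<close> into 16/5.\<close>
  also have "sqrt (2 * L * ?n) = sqrt ((?n * mu i / 24) * (48 * L / mu i))"
    using mu by simp
  also have "\<dots> \<le> (?n * mu i / 24 + 48 * L / mu i) / 2"
    using mu L_ge by (intro arith_geo_mean_sqrt) auto
  finally have "?n * (2 / 3 * mu i) \<le> 2 * ((?n * mu i / 24 + 48 * L / mu i) / 2) + m" by simp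
  moreover have "?n * (2 / 3 * mu i) = 2 / 3 * (mu i * ?n)" "?n * mu i / 24 = mu i * ?n / 24"
    by simp_all
  moreover have "2 * (x / 2) = x" for x :: real by simp
  ultimately have "2 / 3 * (mu i * ?n) \<le> mu i * ?n / 24 + 48 * L / mu i + m"
    by (simp only:)
  moreover have "z \<le> 8 / 5 * y + 16 / 5 * (b + 8 * L + 1)"
    if "2 / 3 * z \<le> z / 24 + y + m" "m \<le> 2 * (b + 8 * L + 1)" for z y b :: real
    using that by linarith
  ultimately have "mu i * ?n \<le> 8 / 5 * (48 * L / mu i) + 16 / 5 * (B * real D / ?k + 8 * L + 1)"
    using m by blast
  also have "8 / 5 * (48 * L / mu i) = 384 / 5 * L / mu i" by simp
  finally show ?thesis .
qed

lemma per_arm: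
  "Delta i * real (r + 2) \<le> 109 * L / Delta i
    + 16 / 5 * real D * min B (gap_max K D Dist) / real (card (act X r))"
proof -
  let ?k = "real (card (act X r))"
  note k = card_act_pos
  have L: "1 \<le> 3 / 2 * L" using L_ge by simp
  have D1: "Delta i \<le> 1" "Delta i \<le> mu i" using Delta_bounds[OF i_less] by auto
  have "L * Delta i \<le> L" using D1 L by (intro mult_left_le) auto
  then have L1: "L \<le> L / Delta i" using gap_pos by (simp add: le_divide_eq)
  have L2: "L / mu i \<le> L / Delta i" using D1 gap_pos L by (intro divide_left_mono) auto
  have gm: "Delta i \<le> gap_max K D Dist"
    unfolding gap_max_def using i_less by (intro Max_ge) auto
  have scale: "real D * x / ?k \<le> 16 / 5 * real D * y / ?k" if "x \<le> 16 / 5 * y" for x y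
  proof -
    have "real D * x / ?k \<le> real D * (16 / 5 * y) / ?k"
      using that by (intro divide_right_mono mult_left_mono) auto
    also have "real D * (16 / 5 * y) = 16 / 5 * real D * y" by simp
    finally show ?thesis .
  qed
  consider "gap_max K D Dist \<le> B \<or> mu i \<le> 3 * B" | "B < gap_max K D Dist" "B < mu i / 3"
    by linarith
  then show ?thesis
  proof cases
    case 1
    \<comment> \<open>If \<open>mu i <= 3 * B\<close>, then \<open>Delta i <= 3 * B\<close>, which
      the factor 16/5 covers.\<close>
    then have "Delta i \<le> 16 / 5 * min B (gap_max K D Dist)"
      using gm D1 gap_pos B_pos unfolding min_def by auto
    from scale[OF this] show ?thesis
      using pulls_le_by_F D1 L L1 by (simp add: algebra_simps)
  next
    case 2
    have "Delta i * real (r + 2) = Delta i * real (Suc r) + Delta i" by (simp add: algebra_simps)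
    also have "\<dots> \<le> mu i * real (Suc r) + 1"
      using D1 by (intro add_mono mult_right_mono) auto
    \<comment> \<open>With \<open>1 <= 3/2 * L\<close> and \<open>L <= L / Delta i\<close>, the
      terms without \<open>B\<close> sum to at most \<open>384/5 + 128/5 + 63/10 = 108.7\<close>
      times \<open>L / Delta i\<close>.\<close>
    finally have "Delta i * real (r + 2) \<le> 384 / 5 * (L / mu i)
        + 16 / 5 * (B * real D / ?k) + 16 / 5 * (8 * L) + 16 / 5 + 1"
      using pulls_le_by_outstanding[OF 2(2)] by (simp add: algebra_simps)
    moreover have "16 / 5 * real D * min B (gap_max K D Dist) / ?k = 16 / 5 * (B * real D / ?k)"
      using 2(1) by (simp add: min_def)
    moreover have "109 * L / Delta i = 109 * (L / Delta i)" by simp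
    moreover have "0 \<le> L / Delta i" using gap_pos L_ge by simp
    ultimately show ?thesis using L L1 L2 by linarith
  qed
qed

end

section \<open>From single arms to the regret of a run\<close>

lemma regret_eq:
  "(\<Sum>s\<in>{1..<start X R}. Delta (asg X R s))
    = (\<Sum>i\<in>{i. i < K \<and> Delta i > 0}. Delta i * real (card {q. q < R \<and> i \<in> act X q}))"
proof -
  have "(\<Sum>s\<in>{1..<start X R}. Delta (asg X R s))
      = (\<Sum>i<K. \<Sum>s\<in>steps X R (start X R) i. Delta (asg X R s))"
    by (rule sum.group[symmetric]) (use asg_in_arms in auto)
  also have "\<dots> = (\<Sum>i<K. Delta i * real (card {q. q < R \<and> i \<in> act X q}))"
    unfolding n_cnt_eq[symmetric] n_cnt_def by (intro sum.cong) auto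
  also have "\<dots> = (\<Sum>i\<in>{i. i < K \<and> Delta i > 0}. Delta i * real (card {q. q < R \<and> i \<in> act X q}))"
    by (intro sum.mono_neutral_right) (use Delta_bounds(1) in force)+
  finally show ?thesis .
qed

lemma cse_regret_eq:
  obtains R where "R \<le> T" "\<forall>q<R. start X q < T"
    "cse_regret K T D B Dist X
      = (\<Sum>i\<in>{i. i < K \<and> Delta i > 0}. Delta i * real (card {q. q < R \<and> i \<in> act X q}))"
proof -
  obtain out tf a where run: "cse_run K T D B X = (out, tf, a)" by (metis surj_pair)
  then have "cse_loop T T D B X (cse_state K T D B X 0) = (out, tf, a)"
    by (simp add: cse_run_def cse_state_def)
  moreover have "act X 0 \<noteq> {}" using K_pos by (auto simp: lessThan_empty_iff)
  ultimately obtain R where "R \<le> T" "tf = start X R" "a = asg X R" "\<forall>q. 0 \<le> q \<and> q < R \<longrightarrow> start X q < T"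
    using cse_loop_state[of T X 0 out tf a] by auto
  then show ?thesis using that[of R] run regret_eq[of X R] by (simp add: cse_regret_def)
qed

text \<open>Active sets only shrink, so the rounds in which an arm is active form an initial
  segment.\<close>

lemma active_rounds:
  assumes "q < card {q. q < R \<and> i \<in> act X q}"
  shows "q < R" "i \<in> act X q"
proof -
  have "\<exists>q'\<ge>q. q' < R \<and> i \<in> act X q'"
  proof (rule ccontr)
    assume "\<not> ?thesis"
    then have "{q. q < R \<and> i \<in> act X q} \<subseteq> {..<q}" by (auto simp: not_le)
    then have "card {q. q < R \<and> i \<in> act X q} \<le> q" using card_mono[of "{..<q}"] by fastforce
    then show False using assms by simp
  qed
  then obtain q' where "q \<le> q'" "q' < R" "i \<in> act X q'" by blast
  then show "q < R" "i \<in> act X q" using act_antimono[of q q' X] by auto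
qed

lemma good_regret:
  fixes X :: "nat \<times> nat \<Rightarrow> nat"
  assumes "good X" and X_le: "\<And>s i. i < K \<Longrightarrow> X (s, i) \<le> D"
  shows "cse_regret K T D B Dist X \<le> (\<Sum>i\<in>{i. i < K \<and> Delta i > 0}. 109 * L / Delta i)
    + 16 / 5 * real D * min B (gap_max K D Dist) * harm (card {i. i < K \<and> Delta i > 0})"
proof -
  let ?A = "{i. i < K \<and> Delta i > 0}"
  obtain R where R: "R \<le> T" "\<forall>q<R. start X q < T"
    and reg: "cse_regret K T D B Dist X = (\<Sum>i\<in>?A. Delta i * real (card {q. q < R \<and> i \<in> act X q}))"
    by (rule cse_regret_eq[of X])
  define N where "N i = card {q. q < R \<and> i \<in> act X q}" for i
  define c where "c = 16 / 5 * real D * min B (gap_max K D Dist)"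
  have c: "0 \<le> c" using B_pos gap_max_nonneg by (simp add: c_def)
  have arm: "Delta i * real (N i) \<le> 109 * L / Delta i + c * (1 / real (card {j \<in> ?A. N j \<ge> N i}))"
    if i: "i \<in> ?A" for i
  proof (cases "N i \<ge> 2")
    case True
    \<comment> \<open>Round \<open>r + 1\<close> is the last one that plays \<open>i\<close>, so
      \<open>i\<close> survived the test after round \<open>r\<close>. Arms played at least as often
      are active then too, so \<open>card (act X r)\<close> is at least the rank of
      \<open>i\<close>.\<close>
    define r where "r = N i - 2"
    have N: "N i = r + 2" using True by (simp add: r_def)
    have mem: "j \<in> act X (Suc r)" "Suc r < R" if "N j \<ge> N i" for j
      using active_rounds[of "Suc r" R j X] that N by (auto simp: N_def)
    have "{j \<in> ?A. N j \<ge> N i} \<subseteq> act X r"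
      using mem(1) act_antimono[of r "Suc r" X] by auto
    then have le: "card {j \<in> ?A. N j \<ge> N i} \<le> card (act X r)" by (intro card_mono) auto
    have pos: "card {j \<in> ?A. N j \<ge> N i} > 0" using i by (auto simp: card_gt_0_iff)
    have "start X (Suc r) \<le> T + K" "Suc r \<le> T" using R mem(2)[of i] by auto
    then have "Delta i * real (N i) \<le> 109 * L / Delta i + c / real (card (act X r))"
      using per_arm[OF assms(1) X_le mem(1)] i N unfolding c_def by simp
    also have "c / real (card (act X r)) \<le> c * (1 / real (card {j \<in> ?A. N j \<ge> N i}))"
      using c le pos by (simp add: divide_left_mono)
    finally show ?thesis by simp
  next
    case False
    have D: "0 < Delta i" "Delta i \<le> 1" using i Delta_bounds by auto
    have "Delta i * real (N i) \<le> 1 * 1" using False D by (intro mult_mono) auto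
    also have "\<dots> \<le> 109 * L / Delta i"
    proof -
      have "1 * Delta i \<le> 109 * L" using D L_ge by linarith
      then show ?thesis using D(1) by (simp add: le_divide_eq)
    qed
    also have "\<dots> \<le> 109 * L / Delta i + c * (1 / real (card {j \<in> ?A. N j \<ge> N i}))" using c by simp
    finally show ?thesis .
  qed
  have "cse_regret K T D B Dist X \<le> (\<Sum>i\<in>?A. 109 * L / Delta i + c * (1 / real (card {j \<in> ?A. N j \<ge> N i})))"
    unfolding reg N_def[symmetric] by (rule sum_mono[OF arm])
  also have "\<dots> = (\<Sum>i\<in>?A. 109 * L / Delta i) + c * (\<Sum>i\<in>?A. 1 / real (card {j \<in> ?A. N j \<ge> N i}))"
    by (simp only: sum.distrib sum_distrib_left)
  also have "\<dots> \<le> (\<Sum>i\<in>?A. 109 * L / Delta i) + c * harm (card ?A)"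
    using c by (intro add_left_mono mult_left_mono sum_inverse_rank_le_harm) auto
  finally show ?thesis by (simp add: c_def)
qed

text \<open>The best arm is not counted, so a nonempty set forces \<open>K >= 2\<close> and
  \<open>ln K >= 2/3\<close>. Then \<open>16/5 = 24/5 * 2/3 <= 24/5 * ln K\<close>, which gives
  \<open>16/5 * (1 + ln K) <= 8 * ln K\<close>.\<close>

lemma harm_gap_le:
  "16 / 5 * real D * min B (gap_max K D Dist) * harm (card {i. i < K \<and> Delta i > 0})
    \<le> 8 * real D * min B (real D * gap_max K D Dist) * ln (real K)"
proof -
  let ?A = "{i. i < K \<and> Delta i > 0}"
  let ?g = "gap_max K D Dist"
  obtain b where b: "b < K" "mu b = mu_star" by (rule mu_star_attained)
  have "?A \<subseteq> {..<K} - {b}" using b by (auto simp: gap_def)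
  then have "card ?A \<le> card ({..<K} - {b})" by (intro card_mono) auto
  then have cA: "card ?A \<le> K - 1" using b by simp
  have "16 / 5 * harm n \<le> 8 * ln (real K)" if "n \<le> K - 1" for n
  proof (cases "n = 0")
    case True
    then show ?thesis using K_pos by (simp add: harm_def)
  next
    case False
    then have "harm n \<le> 1 + ln (real n)" by (intro harm_le_1_plus_ln) simp
    also have "\<dots> \<le> 1 + ln (real K)" using False that by simp
    finally have "harm n \<le> 1 + ln (real K)" .
    moreover have "2 / 3 \<le> ln (real K)"
    proof -
      have "ln 2 \<le> ln (real K)" using False that by simp
      then show ?thesis using ln2_ge_two_thirds by linarith
    qed
    ultimately show ?thesis by linarith
  qed
  note harm = this[OF cA]
  have "?g \<le> real D * ?g" using gap_max_nonneg D_pos by (simp add: mult_le_cancel_right1)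
  then have "real D * min B ?g \<le> real D * min B (real D * ?g)" by (intro mult_left_mono) auto
  then have "(real D * min B ?g) * (16 / 5 * harm (card ?A))
      \<le> (real D * min B (real D * ?g)) * (8 * ln (real K))"
    by (rule mult_mono[OF _ harm]) (use gap_max_nonneg B_pos harm_nonneg in auto)
  then show ?thesis by (simp add: mult_ac)
qed

text \<open>Good tables contribute the constant 109. A bad table costs at most \<open>G * T\<close>,
  in expectation at most \<open>2 * G <= 3 * S\<close> where \<open>S\<close> is the sum of
  \<open>L / Delta i\<close>; the total of 112 is below 129.\<close>

lemma expected_regret_le:
  "measure_pmf.expectation (delay_table K T Dist) (cse_regret K T D B Dist)
   \<le> (\<Sum>i\<in>{i. i < K \<and> Delta i > 0}. 129 * L / Delta i)
     + 8 * real D * min B (real D * gap_max K D Dist) * ln (real K)"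
proof -
  let ?A = "{i. i < K \<and> Delta i > 0}"
  let ?M = "delay_table K T Dist"
  let ?S = "\<Sum>i\<in>?A. L / Delta i"
  let ?H = "8 * real D * min B (real D * gap_max K D Dist) * ln (real K)"
  define G where "G = (\<Sum>i\<in>?A. Delta i)"
  have set_M: "set_pmf ?M = PiE_dflt ({1..<T + K} \<times> {..<K}) 0 (set_pmf \<circ> (\<lambda>(s, i). Dist i))"
    unfolding delay_table_def by (rule set_Pi_pmf) simp
  have fin: "finite (set_pmf ?M)"
    unfolding set_M by (rule finite_PiE_dflt) (auto intro: finite_support)
  note int = integrable_measure_pmf_finite[OF fin]
  \<comment> \<open>Entries outside the index set have the default value 0, so the bound holds for
    every \<open>s\<close>.\<close>
  have X_le: "X (s, i) \<le> D" if "X \<in> set_pmf ?M" "i < K" for X s i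
    using that supp unfolding set_M PiE_dflt_def by (cases "s \<in> {1..<T + K}") fastforce+
  have H: "0 \<le> ?H" using B_pos K_pos gap_max_nonneg by simp
  have G: "0 \<le> G" "G \<le> 3 / 2 * ?S"
  proof -
    show "0 \<le> G" unfolding G_def by (intro sum_nonneg) auto
    show "G \<le> 3 / 2 * ?S" unfolding G_def sum_distrib_left
    proof (rule sum_mono)
      fix i assume "i \<in> ?A"
      then have D: "0 < Delta i" "Delta i \<le> 1" using Delta_bounds by auto
      have "Delta i * Delta i \<le> 1 * 1" using D by (intro mult_mono) auto
      then have "Delta i * Delta i \<le> 3 / 2 * L" using L_ge by linarith
      then show "Delta i \<le> 3 / 2 * (L / Delta i)" using D(1) by (simp add: le_divide_eq)
    qed
  qed
  have S: "0 \<le> ?S" using L_ge by (intro sum_nonneg) auto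
  \<comment> \<open>A round plays each arm at most once, so the regret is at most \<open>G\<close>
    per round. For \<open>K >= T\<close> the first round ends at time \<open>K + 1 > T\<close> and
    no second one starts.\<close>
  have bad: "cse_regret K T D B Dist X \<le> G * real (if K < T then T else 1)" for X
  proof -
    obtain R where R: "R \<le> T" "\<forall>q<R. start X q < T"
      and reg: "cse_regret K T D B Dist X = (\<Sum>i\<in>?A. Delta i * real (card {q. q < R \<and> i \<in> act X q}))"
      by (rule cse_regret_eq[of X])
    have "R \<le> (if K < T then T else 1)"
    proof (cases "K < T \<or> R \<le> 1")
      case False
      then have "start X 1 < T" using R(2) by simp
      then show ?thesis using False by (simp add: start_Suc)
    qed (use R(1) T_ge_2 in auto)
    moreover have "card {q. q < R \<and> i \<in> act X q} \<le> R" for i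
      using card_mono[of "{..<R}" "{q. q < R \<and> i \<in> act X q}"] by auto
    ultimately have "card {q. q < R \<and> i \<in> act X q} \<le> (if K < T then T else 1)" for i
      using le_trans by blast
    then show ?thesis unfolding reg G_def sum_distrib_right
      by (intro sum_mono mult_left_mono of_nat_mono) auto
  qed
  have "measure_pmf.expectation ?M (cse_regret K T D B Dist) \<le> 112 * ?S + ?H"
  proof (cases "K < T")
    case True
    let ?E = "{X. \<not> good X}"
    have "measure_pmf.expectation ?M (cse_regret K T D B Dist)
        \<le> measure_pmf.expectation ?M (\<lambda>X. (109 * ?S + ?H) + G * real T * indicator ?E X)"
    proof (intro integral_mono_AE int)
      show "AE X in ?M. cse_regret K T D B Dist X \<le> (109 * ?S + ?H) + G * real T * indicator ?E X"
        unfolding AE_measure_pmf_iff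
      proof
        fix X assume X: "X \<in> set_pmf ?M"
        show "cse_regret K T D B Dist X \<le> (109 * ?S + ?H) + G * real T * indicator ?E X"
        proof (cases "good X")
          case True
          have "(\<Sum>i\<in>?A. 109 * L / Delta i) = 109 * ?S" by (simp add: sum_distrib_left)
          moreover have "G * real T * indicator ?E X = 0" using True by simp
          moreover have "cse_regret K T D B Dist X \<le> (\<Sum>i\<in>?A. 109 * L / Delta i)
              + 16 / 5 * real D * min B (gap_max K D Dist) * harm (card ?A)"
            by (rule good_regret[OF True]) (use X_le[OF X] in blast)
          moreover note harm_gap_le
          ultimately show ?thesis by linarith
        next
          case False
          then have "G * real T * indicator ?E X = G * real T" by simp
          moreover have "cse_regret K T D B Dist X \<le> G * real T" using bad[of X] \<open>K < T\<close> by simp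
          ultimately show ?thesis using H S by linarith
        qed
      qed
    qed
    also have "\<dots> = (109 * ?S + ?H) + G * (real T * measure_pmf.prob ?M ?E)"
      by (subst Bochner_Integration.integral_add[OF int int]) simp
    also have "\<dots> \<le> (109 * ?S + ?H) + G * 2"
      using prob_bad[OF True] G(1) by (intro add_left_mono mult_left_mono) auto
    finally show ?thesis using G(2) by linarith
  next
    case False
    have "measure_pmf.expectation ?M (cse_regret K T D B Dist) \<le> measure_pmf.expectation ?M (\<lambda>_. G)"
      using bad False by (intro integral_mono int) simp
    also have "\<dots> = G" by simp
    finally show ?thesis using G S H by linarith
  qed
  also have "112 * ?S + ?H \<le> 129 * ?S + ?H" using S by simp
  also have "129 * ?S = (\<Sum>i\<in>?A. 129 * L / Delta i)" by (simp add: sum_distrib_left)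
  finally show ?thesis .
qed

end

theorem theorem1:
  fixes K T D :: nat and B :: real and Dist :: "nat \<Rightarrow> nat pmf"
  assumes "K \<ge> 1" and "D \<ge> 1" and "T \<ge> 1" and "B > 0"
    and "\<And>i. i < K \<Longrightarrow> set_pmf (Dist i) \<subseteq> {0..D}"
    and "\<exists>!i. i < K \<and> mean_cost D Dist i = Min (mean_cost D Dist ` {..<K})"
  shows "measure_pmf.expectation (delay_table K T Dist) (cse_regret K T D B Dist)
         \<le> (\<Sum>i\<in>{i. i < K \<and> gap K D Dist i > 0}. 129 * ln (real T) / gap K D Dist i)
           + 8 * real D * min B (real D * gap_max K D Dist) * ln (real K)"
proof (cases "T = 1")
  \<comment> \<open>The locale requires \<open>T >= 2\<close> to keep \<open>L\<close> away from 0.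
    For \<open>T = 1\<close> no round is played and the regret vanishes.\<close>
  case True
  have "0 \<le> gap K D Dist 0" using assms(1) by (simp add: gap_def)
  also have "\<dots> \<le> gap_max K D Dist"
    unfolding gap_max_def using assms(1) by (intro Max_ge) auto
  finally have "0 \<le> 8 * real D * min B (real D * gap_max K D Dist) * ln (real K)"
    using assms(1,4) by simp
  moreover have "cse_regret K T D B Dist = (\<lambda>_. 0)"
    unfolding True by (auto simp: cse_regret_def cse_run_def)
  ultimately show ?thesis unfolding True by simp
next
  case False
  then interpret cse_bandit K T D B Dist
    using assms by unfold_locales auto
  show ?thesis by (rule expected_regret_le)
qed

end
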